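(* $\mathrm{WPT}^- + \mathrm{INT}$ is model-theoretically conservative over $\mathrm{PA}$; that is, every model $\mathcal{M}\models\mathrm{PA}$ admits an expansion $(\mathcal{M},T)\models\mathrm{WPT}^-+\mathrm{INT}$.
   Context: Conventions. $\mathcal{L}_{\mathrm{PA}}$ is the language of Peano Arithmetic $\mathrm{PA}$ and $\mathcal{L}_T=\mathcal{L}_{\mathrm{PA}}\cup\{T\}$ with $T$ a new unary predicate. Syntax is arithmetized inside $\mathrm{PA}$, and symbols for syntactic operations on codes are suppressed. Inside arithmetic, $\phi,\psi$ range over codes of $\mathcal{L}_{\mathrm{PA}}$-sentences; $\phi(v)$ over codes of $\mathcal{L}_{\mathrm{PA}}$-formulae with at most one free variable; $s,t$ over codes of closed arithmetical terms; $v$ over codes of variables. $\underline{x}$ is (the code of) the standard numeral for $x$; $s^\circ$ is the value of the closed term coded by $s$. In the arithmetized language $\neg,\vee,\exists$ are primitive, and $\wedge,\forall$ are abbreviations. $\mathrm{tot}(\phi(v))$ is the formula "$\phi(v)$ is an $\mathcal{L}_{\mathrm{PA}}$-formula with at most one free variable, and $\forall x\,(T(\phi(\underline{x}))\vee T(\neg\phi(\underline{x})))$" (for a sentence $\psi$, $\mathrm{tot}(\psi)$ amounts to $T(\psi)\vee T(\neg\psi)$). $\mathrm{WPT}^-$ is the $\mathcal{L}_T$-theory consisting of $\mathrm{PA}$ (induction only for $\mathcal{L}_{\mathrm{PA}}$-formulae) and the axioms: (1a) $\forall s,t\,(T(s=t)\equiv s^\circ=t^\circ)$; (1b) $\forall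 s,t\,(T(\neg s=t)\equiv s^\circ\neq t^\circ)$; (2a) $\forall\phi,\psi\,\bigl(T(\phi\vee\psi)\equiv(\mathrm{tot}(\phi)\wedge\mathrm{tot}(\psi)\wedge(T(\phi)\vee T(\psi)))\bigr)$; (2b) $\forall\phi,\psi\,(T(\neg(\phi\vee\psi))\equiv T(\neg\phi)\wedge T(\neg\psi))$; (3a) $\forall v\forall\phi(v)\,(T(\exists v\phi)\equiv\mathrm{tot}(\phi(v))\wedge\exists x\,T(\phi(\underline{x})))$; (3b) $\forall v\forall\phi(v)\,(T(\neg\exists v\phi)\equiv\forall x\,T(\neg\phi(\underline{x})))$; (4) $\forall\phi\,(T(\neg\neg\phi)\equiv T(\phi))$; (5) $\forall\phi(v)\,\forall s,t\,(s^\circ=t^\circ\rightarrow(T(\phi(s))\equiv T(\phi(t))))$. $\mathrm{INT}$ is the $\mathcal{L}_T$-sentence $$\forall\phi(v)\Bigl[\forall x\,\bigl(T(\phi(\underline{x}))\rightarrow T(\phi(\underline{x+1}))\bigr)\rightarrow\bigl(T(\phi(0))\rightarrow\forall x\,T(\phi(\underline{x}))\bigr)\Bigr].$$ An expansion of $\mathcal{M}$ is the same model (same domain and arithmetical structure) together with an interpretation of $T$. *)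

theory Defs
  imports Main
begin

section \<open>The languages and their semantics\<close>

datatype tm = Var nat | Zero | Succ tm | Add tm tm | Mult tm tm

text \<open>Formulae of the language with the truth predicate \<open>Tr\<close>; the arithmetical formulae are
  those in which \<open>Tr\<close> does not occur.\<close>

datatype fm = Eq tm tm | Tr tm | Neg fm | Or fm fm | Ex nat fm

fun arithmetical :: "fm \<Rightarrow> bool" where
  "arithmetical (Eq s t) = True"
| "arithmetical (Tr t) = False"
| "arithmetical (Neg p) = arithmetical p"
| "arithmetical (Or p q) = (arithmetical p \<and> arithmetical q)"
| "arithmetical (Ex v p) = arithmetical p"

definition And :: "fm \<Rightarrow> fm \<Rightarrow> fm" where "And p q = Neg (Or (Neg p) (Neg q))"
definition Imp :: "fm \<Rightarrow> fm \<Rightarrow> fm" where "Imp p q = Or (Neg p) q"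
definition All :: "nat \<Rightarrow> fm \<Rightarrow> fm" where "All v p = Neg (Ex v (Neg p))"

record 'a pa_structure =
  zeroM :: 'a
  succM :: "'a \<Rightarrow> 'a"
  addM :: "'a \<Rightarrow> 'a \<Rightarrow> 'a"
  multM :: "'a \<Rightarrow> 'a \<Rightarrow> 'a"

fun val :: "'a pa_structure \<Rightarrow> (nat \<Rightarrow> 'a) \<Rightarrow> tm \<Rightarrow> 'a" where
  "val M e (Var i) = e i"
| "val M e Zero = zeroM M"
| "val M e (Succ t) = succM M (val M e t)"
| "val M e (Add s t) = addM M (val M e s) (val M e t)"
| "val M e (Mult s t) = multM M (val M e s) (val M e t)"

fun sat :: "'a pa_structure \<Rightarrow> 'a set \<Rightarrow> (nat \<Rightarrow> 'a) \<Rightarrow> fm \<Rightarrow> bool" where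
  "sat M T e (Eq s t) \<longleftrightarrow> val M e s = val M e t"
| "sat M T e (Tr t) \<longleftrightarrow> val M e t \<in> T"
| "sat M T e (Neg p) \<longleftrightarrow> \<not> sat M T e p"
| "sat M T e (Or p q) \<longleftrightarrow> sat M T e p \<or> sat M T e q"
| "sat M T e (Ex v p) \<longleftrightarrow> (\<exists>a. sat M T (e(v := a)) p)"

text \<open>Open formulae are identified with their universal closures.\<close>

definition models :: "'a pa_structure \<Rightarrow> 'a set \<Rightarrow> fm set \<Rightarrow> bool" where
  "models M T \<Gamma> \<longleftrightarrow> (\<forall>p\<in>\<Gamma>. \<forall>e. sat M T e p)"

lemma sat_arithmetical_cong:
  "arithmetical p \<Longrightarrow> sat M T e p = sat M T' e p"
  by (induction p arbitrary: e) auto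


section \<open>Peano Arithmetic\<close>

fun subst_tm :: "nat \<Rightarrow> tm \<Rightarrow> tm \<Rightarrow> tm" where
  "subst_tm v r (Var i) = (if i = v then r else Var i)"
| "subst_tm v r Zero = Zero"
| "subst_tm v r (Succ t) = Succ (subst_tm v r t)"
| "subst_tm v r (Add s t) = Add (subst_tm v r s) (subst_tm v r t)"
| "subst_tm v r (Mult s t) = Mult (subst_tm v r s) (subst_tm v r t)"

text \<open>Substitution for the free occurrences of a variable \<open>v\<close>. Bound variables are not renamed;
  the substituted terms below have at most the variable \<open>v\<close>, so that no capture can occur.\<close>

fun subst_fm :: "nat \<Rightarrow> tm \<Rightarrow> fm \<Rightarrow> fm" where
  "subst_fm v r (Eq s t) = Eq (subst_tm v r s) (subst_tm v r t)"
| "subst_fm v r (Tr t) = Tr (subst_tm v r t)"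
| "subst_fm v r (Neg p) = Neg (subst_fm v r p)"
| "subst_fm v r (Or p q) = Or (subst_fm v r p) (subst_fm v r q)"
| "subst_fm v r (Ex u p) = (if u = v then Ex u p else Ex u (subst_fm v r p))"

definition induction_axiom :: "nat \<Rightarrow> fm \<Rightarrow> fm" where
  "induction_axiom v p =
    Imp (And (subst_fm v Zero p) (All v (Imp p (subst_fm v (Succ (Var v)) p)))) (All v p)"

definition PA :: "fm set" where
  "PA =
    { Neg (Eq (Succ (Var 0)) Zero),
      Imp (Eq (Succ (Var 0)) (Succ (Var 1))) (Eq (Var 0) (Var 1)),
      Eq (Add (Var 0) Zero) (Var 0),
      Eq (Add (Var 0) (Succ (Var 1))) (Succ (Add (Var 0) (Var 1))),
      Eq (Mult (Var 0) Zero) Zero,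
      Eq (Mult (Var 0) (Succ (Var 1))) (Add (Mult (Var 0) (Var 1)) (Var 0)) }
    \<union> { induction_axiom v p | v p. arithmetical p }"

lemma arithmetical_subst_fm [simp]: "arithmetical (subst_fm v r p) = arithmetical p"
  by (induction p) auto

lemma arithmetical_PA: "p \<in> PA \<Longrightarrow> arithmetical p"
  by (auto simp: PA_def induction_axiom_def Imp_def And_def All_def)

text \<open>The interpretation of \<open>Tr\<close> is irrelevant for arithmetical formulae, so the empty one is
  used.\<close>

definition PA_model :: "'a pa_structure \<Rightarrow> bool" where
  "PA_model M \<longleftrightarrow> models M {} PA"

lemma PA_model_iff: "PA_model M \<longleftrightarrow> models M T PA"
  unfolding PA_model_def models_def using arithmetical_PA sat_arithmetical_cong by metis


section \<open>Writing formulae with automatically chosen bound variables\<close>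

text \<open>A formula is written as a function of the index \<open>n\<close> of the next unused variable: all
  variables of the ambient terms have indices below \<open>n\<close>, and a quantifier met at \<open>n\<close> binds
  \<open>Var n\<close>. Hence bound variables never clash, and a closed formula \<open>F\<close> is turned into an actual
  sentence by \<open>F 0\<close>.\<close>

type_synonym fmb = "nat \<Rightarrow> fm"

definition bEq :: "tm \<Rightarrow> tm \<Rightarrow> fmb" (infix "\<^bold>=" 50)
  where "(s \<^bold>= t) n = Eq s t"
definition bTr :: "tm \<Rightarrow> fmb" ("\<^bold>T")
  where "\<^bold>T t n = Tr t"
definition bNeg :: "fmb \<Rightarrow> fmb" ("\<^bold>\<not> _" [40] 40)
  where "(\<^bold>\<not> F) n = Neg (F n)"
definition bOr :: "fmb \<Rightarrow> fmb \<Rightarrow> fmb" (infixr "\<^bold>\<or>" 30)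
  where "(F \<^bold>\<or> G) n = Or (F n) (G n)"
definition bEx :: "(tm \<Rightarrow> fmb) \<Rightarrow> fmb" (binder "\<^bold>\<exists>" 10)
  where "bEx F n = Ex n (F (Var n) (Suc n))"
definition bAnd :: "fmb \<Rightarrow> fmb \<Rightarrow> fmb" (infixr "\<^bold>\<and>" 35)
  where "(F \<^bold>\<and> G) n = And (F n) (G n)"
definition bImp :: "fmb \<Rightarrow> fmb \<Rightarrow> fmb" (infixr "\<^bold>\<longrightarrow>" 25)
  where "(F \<^bold>\<longrightarrow> G) n = Imp (F n) (G n)"
definition bIff :: "fmb \<Rightarrow> fmb \<Rightarrow> fmb" (infixr "\<^bold>\<longleftrightarrow>" 25)
  where "(F \<^bold>\<longleftrightarrow> G) n = And (Imp (F n) (G n)) (Imp (G n) (F n))"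
definition bAll :: "(tm \<Rightarrow> fmb) \<Rightarrow> fmb" (binder "\<^bold>\<forall>" 10)
  where "bAll F n = All n (F (Var n) (Suc n))"


section \<open>Arithmetized syntax\<close>

text \<open>The pairing function \<open>(x, y) \<mapsto> (x + y)\<^sup>2 + x\<close> is injective and is given by a term.\<close>

definition pr :: "tm \<Rightarrow> tm \<Rightarrow> tm" where
  "pr x y = Add (Mult (Add x y) (Add x y)) x"

fun num :: "nat \<Rightarrow> tm" where
  "num 0 = Zero"
| "num (Suc k) = Succ (num k)"

text \<open>Codes of variables, terms and formulae, as terms in the codes of their constituents. In
  \<open>cEx v p\<close> the argument \<open>v\<close> is the code of a variable, not its index.\<close>

definition cVar :: "tm \<Rightarrow> tm" where "cVar i = pr (num 0) i"
definition cZero :: tm where "cZero = pr (num 1) Zero"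
definition cSucc :: "tm \<Rightarrow> tm" where "cSucc s = pr (num 2) s"
definition cAdd :: "tm \<Rightarrow> tm \<Rightarrow> tm" where "cAdd s t = pr (num 3) (pr s t)"
definition cMult :: "tm \<Rightarrow> tm \<Rightarrow> tm" where "cMult s t = pr (num 4) (pr s t)"
definition cEq :: "tm \<Rightarrow> tm \<Rightarrow> tm" where "cEq s t = pr (num 5) (pr s t)"
definition cNeg :: "tm \<Rightarrow> tm" where "cNeg p = pr (num 6) p"
definition cOr :: "tm \<Rightarrow> tm \<Rightarrow> tm" where "cOr p q = pr (num 7) (pr p q)"
definition cEx :: "tm \<Rightarrow> tm \<Rightarrow> tm" where "cEx v p = pr (num 8) (pr v p)"

text \<open>The numbers \<open>b, d, m\<close> code the finite set of all \<open>x < b\<close> such that \<open>1 + (x + 1) * m\<close>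
  divides \<open>d\<close>. As in the lemma on Goedel's beta function, PA proves that every definable
  bounded set has such a code.\<close>

definition mem :: "tm \<Rightarrow> tm \<Rightarrow> tm \<Rightarrow> tm \<Rightarrow> fmb" where
  "mem x b d m = ((\<^bold>\<exists>z. Add x (Succ z) \<^bold>= b) \<^bold>\<and>
                  (\<^bold>\<exists>q. Mult (Succ (Mult (Succ x) m)) q \<^bold>= d))"

text \<open>Inductively generated sets: \<open>x\<close> belongs to a finite coded set each of whose elements \<open>y\<close>
  is obtained, by a rule of \<open>R\<close>, from elements of this set. In all uses below the rules produce
  larger codes from smaller ones.\<close>

definition generated :: "((tm \<Rightarrow> fmb) \<Rightarrow> tm \<Rightarrow> fmb) \<Rightarrow> tm \<Rightarrow> fmb" where
  "generated R x = (\<^bold>\<exists>b. \<^bold>\<exists>d. \<^bold>\<exists>m. mem x b d m \<^bold>\<and>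
     (\<^bold>\<forall>y. mem y b d m \<^bold>\<longrightarrow> R (\<lambda>z. mem z b d m) y))"

definition is_var :: "tm \<Rightarrow> fmb" where
  "is_var v = (\<^bold>\<exists>i. v \<^bold>= cVar i)"

definition is_term :: "tm \<Rightarrow> fmb" where
  "is_term = generated (\<lambda>X y.
     is_var y \<^bold>\<or>
     y \<^bold>= cZero \<^bold>\<or>
     (\<^bold>\<exists>s. X s \<^bold>\<and> y \<^bold>= cSucc s) \<^bold>\<or>
     (\<^bold>\<exists>s. \<^bold>\<exists>t. X s \<^bold>\<and> X t \<^bold>\<and> (y \<^bold>= cAdd s t \<^bold>\<or> y \<^bold>= cMult s t)))"

definition is_form :: "tm \<Rightarrow> fmb" where
  "is_form = generated (\<lambda>X y.
     (\<^bold>\<exists>s. \<^bold>\<exists>t. is_term s \<^bold>\<and> is_term t \<^bold>\<and> y \<^bold>= cEq s t) \<^bold>\<or>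
     (\<^bold>\<exists>p. X p \<^bold>\<and> y \<^bold>= cNeg p) \<^bold>\<or>
     (\<^bold>\<exists>p. \<^bold>\<exists>q. X p \<^bold>\<and> X q \<^bold>\<and> y \<^bold>= cOr p q) \<^bold>\<or>
     (\<^bold>\<exists>v. \<^bold>\<exists>p. is_var v \<^bold>\<and> X p \<^bold>\<and> y \<^bold>= cEx v p))"

text \<open>The variable \<open>v\<close> occurs free in the term or formula \<open>x\<close>.\<close>

definition occurs_free :: "tm \<Rightarrow> tm \<Rightarrow> fmb" where
  "occurs_free v = generated (\<lambda>X y.
     y \<^bold>= v \<^bold>\<or>
     (\<^bold>\<exists>s. X s \<^bold>\<and> (y \<^bold>= cSucc s \<^bold>\<or> y \<^bold>= cNeg s)) \<^bold>\<or>
     (\<^bold>\<exists>s. \<^bold>\<exists>t. (X s \<^bold>\<or> X t) \<^bold>\<and>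
        (y \<^bold>= cAdd s t \<^bold>\<or> y \<^bold>= cMult s t \<^bold>\<or> y \<^bold>= cEq s t \<^bold>\<or> y \<^bold>= cOr s t)) \<^bold>\<or>
     (\<^bold>\<exists>u. \<^bold>\<exists>p. \<^bold>\<not> (u \<^bold>= v) \<^bold>\<and> X p \<^bold>\<and> y \<^bold>= cEx u p))"

definition is_closed_term :: "tm \<Rightarrow> fmb" where
  "is_closed_term s = (is_term s \<^bold>\<and> (\<^bold>\<forall>v. is_var v \<^bold>\<longrightarrow> \<^bold>\<not> occurs_free v s))"

definition is_sentence :: "tm \<Rightarrow> fmb" where
  "is_sentence p = (is_form p \<^bold>\<and> (\<^bold>\<forall>v. is_var v \<^bold>\<longrightarrow> \<^bold>\<not> occurs_free v p))"

text \<open>\<open>p\<close> is a formula in which at most the variable \<open>v\<close> is free.\<close>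

definition is_form_in :: "tm \<Rightarrow> tm \<Rightarrow> fmb" where
  "is_form_in v p = (is_var v \<^bold>\<and> is_form p \<^bold>\<and>
     (\<^bold>\<forall>u. is_var u \<^bold>\<and> occurs_free u p \<^bold>\<longrightarrow> u \<^bold>= v))"

definition is_form1 :: "tm \<Rightarrow> fmb" where
  "is_form1 p = (\<^bold>\<exists>v. is_form_in v p)"

text \<open>The functions of arithmetized syntax that are not given by terms are represented by their
  graphs, which are generated as sets of pairs.\<close>

text \<open>\<open>n\<close> is the numeral of \<open>x\<close>.\<close>

definition is_numeral :: "tm \<Rightarrow> tm \<Rightarrow> fmb" where
  "is_numeral x n = generated (\<lambda>X y.
     y \<^bold>= pr Zero cZero \<^bold>\<or>
     (\<^bold>\<exists>a. \<^bold>\<exists>k. X (pr a k) \<^bold>\<and> y \<^bold>= pr (Succ a) (cSucc k))) (pr x n)"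

text \<open>\<open>a\<close> is the value of the closed term \<open>s\<close>.\<close>

definition is_value :: "tm \<Rightarrow> tm \<Rightarrow> fmb" where
  "is_value s a = generated (\<lambda>X y.
     y \<^bold>= pr cZero Zero \<^bold>\<or>
     (\<^bold>\<exists>s. \<^bold>\<exists>a. X (pr s a) \<^bold>\<and> y \<^bold>= pr (cSucc s) (Succ a)) \<^bold>\<or>
     (\<^bold>\<exists>s. \<^bold>\<exists>t. \<^bold>\<exists>a. \<^bold>\<exists>b. X (pr s a) \<^bold>\<and> X (pr t b) \<^bold>\<and>
        (y \<^bold>= pr (cAdd s t) (Add a b) \<^bold>\<or> y \<^bold>= pr (cMult s t) (Mult a b)))) (pr s a)"

text \<open>\<open>x'\<close> is the result of substituting the closed term \<open>r\<close> for the free occurrences of the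
  variable \<open>v\<close> in the term or formula \<open>x\<close>.\<close>

definition is_subst :: "tm \<Rightarrow> tm \<Rightarrow> tm \<Rightarrow> tm \<Rightarrow> fmb" where
  "is_subst v r x x' = generated (\<lambda>X y.
     y \<^bold>= pr v r \<^bold>\<or>
     (\<^bold>\<exists>u. is_var u \<^bold>\<and> \<^bold>\<not> (u \<^bold>= v) \<^bold>\<and> y \<^bold>= pr u u) \<^bold>\<or>
     y \<^bold>= pr cZero cZero \<^bold>\<or>
     (\<^bold>\<exists>s. \<^bold>\<exists>s'. X (pr s s') \<^bold>\<and>
        (y \<^bold>= pr (cSucc s) (cSucc s') \<^bold>\<or> y \<^bold>= pr (cNeg s) (cNeg s'))) \<^bold>\<or>
     (\<^bold>\<exists>s. \<^bold>\<exists>s'. \<^bold>\<exists>t. \<^bold>\<exists>t'. X (pr s s') \<^bold>\<and> X (pr t t') \<^bold>\<and>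
        (y \<^bold>= pr (cAdd s t) (cAdd s' t') \<^bold>\<or> y \<^bold>= pr (cMult s t) (cMult s' t') \<^bold>\<or>
         y \<^bold>= pr (cEq s t) (cEq s' t') \<^bold>\<or> y \<^bold>= pr (cOr s t) (cOr s' t'))) \<^bold>\<or>
     (\<^bold>\<exists>p. y \<^bold>= pr (cEx v p) (cEx v p)) \<^bold>\<or>
     (\<^bold>\<exists>u. \<^bold>\<exists>p. \<^bold>\<exists>p'. \<^bold>\<not> (u \<^bold>= v) \<^bold>\<and> X (pr p p') \<^bold>\<and>
        y \<^bold>= pr (cEx u p) (cEx u p'))) (pr x x')"

text \<open>\<open>at_term p r F\<close> says that \<open>F\<close> holds of \<open>p(r)\<close>, the result of substituting the closed term
  \<open>r\<close> for the free variable of \<open>p\<close>, where \<open>p\<close> has at most one free variable; if \<open>p\<close> is a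
  sentence, then any \<open>v\<close> may be chosen and \<open>p(r)\<close> is \<open>p\<close>. Similarly, \<open>at_num p x F\<close> says that
  \<open>F\<close> holds of \<open>p(n)\<close> for the numeral \<open>n\<close> of \<open>x\<close>.\<close>

definition at_term :: "tm \<Rightarrow> tm \<Rightarrow> (tm \<Rightarrow> fmb) \<Rightarrow> fmb" where
  "at_term p r F = (\<^bold>\<exists>v. \<^bold>\<exists>q. is_form_in v p \<^bold>\<and> is_subst v r p q \<^bold>\<and> F q)"

definition at_num :: "tm \<Rightarrow> tm \<Rightarrow> (tm \<Rightarrow> fmb) \<Rightarrow> fmb" where
  "at_num p x F = (\<^bold>\<exists>n. is_numeral x n \<^bold>\<and> at_term p n F)"


section \<open>The theory of weak Kleene positive truth and internal induction\<close>

definition tot :: "tm \<Rightarrow> fmb" where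
  "tot p = (is_form1 p \<^bold>\<and> (\<^bold>\<forall>x. at_num p x \<^bold>T \<^bold>\<or> at_num p x (\<lambda>q. \<^bold>T (cNeg q))))"

definition ax_eq :: fmb where
  "ax_eq = (\<^bold>\<forall>s. \<^bold>\<forall>t. is_closed_term s \<^bold>\<and> is_closed_term t \<^bold>\<longrightarrow>
     (\<^bold>T (cEq s t) \<^bold>\<longleftrightarrow> (\<^bold>\<exists>a. \<^bold>\<exists>b. is_value s a \<^bold>\<and> is_value t b \<^bold>\<and> a \<^bold>= b)))"

definition ax_neq :: fmb where
  "ax_neq = (\<^bold>\<forall>s. \<^bold>\<forall>t. is_closed_term s \<^bold>\<and> is_closed_term t \<^bold>\<longrightarrow>
     (\<^bold>T (cNeg (cEq s t)) \<^bold>\<longleftrightarrow>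
        (\<^bold>\<exists>a. \<^bold>\<exists>b. is_value s a \<^bold>\<and> is_value t b \<^bold>\<and> \<^bold>\<not> (a \<^bold>= b))))"

definition ax_or :: fmb where
  "ax_or = (\<^bold>\<forall>p. \<^bold>\<forall>q. is_sentence p \<^bold>\<and> is_sentence q \<^bold>\<longrightarrow>
     (\<^bold>T (cOr p q) \<^bold>\<longleftrightarrow> tot p \<^bold>\<and> tot q \<^bold>\<and> (\<^bold>T p \<^bold>\<or> \<^bold>T q)))"

definition ax_nor :: fmb where
  "ax_nor = (\<^bold>\<forall>p. \<^bold>\<forall>q. is_sentence p \<^bold>\<and> is_sentence q \<^bold>\<longrightarrow>
     (\<^bold>T (cNeg (cOr p q)) \<^bold>\<longleftrightarrow> \<^bold>T (cNeg p) \<^bold>\<and> \<^bold>T (cNeg q)))"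

definition ax_ex :: fmb where
  "ax_ex = (\<^bold>\<forall>v. \<^bold>\<forall>p. is_form_in v p \<^bold>\<longrightarrow>
     (\<^bold>T (cEx v p) \<^bold>\<longleftrightarrow> tot p \<^bold>\<and> (\<^bold>\<exists>x. at_num p x \<^bold>T)))"

definition ax_nex :: fmb where
  "ax_nex = (\<^bold>\<forall>v. \<^bold>\<forall>p. is_form_in v p \<^bold>\<longrightarrow>
     (\<^bold>T (cNeg (cEx v p)) \<^bold>\<longleftrightarrow> (\<^bold>\<forall>x. at_num p x (\<lambda>q. \<^bold>T (cNeg q)))))"

definition ax_neg :: fmb where
  "ax_neg = (\<^bold>\<forall>p. is_sentence p \<^bold>\<longrightarrow> (\<^bold>T (cNeg (cNeg p)) \<^bold>\<longleftrightarrow> \<^bold>T p))"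

definition ax_reg :: fmb where
  "ax_reg = (\<^bold>\<forall>p. \<^bold>\<forall>s. \<^bold>\<forall>t. is_form1 p \<^bold>\<and> is_closed_term s \<^bold>\<and> is_closed_term t \<^bold>\<longrightarrow>
     (\<^bold>\<exists>a. \<^bold>\<exists>b. is_value s a \<^bold>\<and> is_value t b \<^bold>\<and> a \<^bold>= b) \<^bold>\<longrightarrow>
     (at_term p s \<^bold>T \<^bold>\<longleftrightarrow> at_term p t \<^bold>T))"

definition WPT_minus :: "fm set" where
  "WPT_minus = PA \<union>
     { ax_eq 0, ax_neq 0, ax_or 0, ax_nor 0, ax_ex 0, ax_nex 0, ax_neg 0, ax_reg 0 }"

text \<open>The sentence INT.\<close>

definition internal_induction :: fm where
  "internal_induction = (\<^bold>\<forall>p. is_form1 p \<^bold>\<longrightarrow>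
     (\<^bold>\<forall>x. at_num p x \<^bold>T \<^bold>\<longrightarrow> at_num p (Succ x) \<^bold>T) \<^bold>\<longrightarrow>
     at_num p Zero \<^bold>T \<^bold>\<longrightarrow> (\<^bold>\<forall>x. at_num p x \<^bold>T)) 0"

end

theory Submission
  imports Defs
begin

text \<open>The axioms of weak Kleene truth allow a sentence to be neither true nor false, as long as a
  compound sentence is so exactly when one of its constituents or instances is. So let truth be
  undefined for every sentence (in the sense of the model) whose tree of connectives and quantifiers
  has nonstandard depth, and let it be ordinary truth for the sentences of standard depth; the terms
  in these may still be nonstandard.

  For each standard \<open>k\<close>, the sentences of depth below \<open>k\<close> have a truth predicate
  \<open>true_below k\<close> that is arithmetically definable in the model, by recursion on \<open>k\<close> outside of
  the model. These predicates cohere (\<open>true_below_Suc\<close>), and \<open>Truth\<close>, their union, satisfies the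
  truth axioms: a sentence has standard depth if and only if all its immediate constituents or
  instances have, so that \<open>tot\<close> expresses exactly standard depth (\<open>Tot_iff\<close>) and both sides
  of each axiom fail beyond it. Regularity is an external induction on depth
  (\<open>true_below_regular\<close>).

  \<open>Truth\<close> itself is not definable, but internal induction concerns one formula \<open>p\<close> at a time. If
  some instance of \<open>p\<close> is true, then \<open>p\<close> has standard depth, all its instances have the same depth,
  and \<open>{x. p(x) is true}\<close> is a definable set, to which the induction scheme of PA applies
  (\<open>Truth_induction\<close>).

  Most of the work is the arithmetization inside an arbitrary model. It rests on three
  tools: a calculus of relations definable with parameters (\<open>pdef\<close>, \<open>dfn\<close>), which turns the
  induction scheme into the rules \<open>pa_induct\<close> and \<open>less_induct_M\<close>; the coding of bounded definable
  sets (\<open>comprehension\<close>), in the manner of Goedel's beta function; and the resulting fixed point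
  equation for inductively generated predicates (\<open>Gen_unfold\<close>), from which the
  recursion equations for terms, formulae, substitution, numerals and values follow.\<close>

section \<open>Fresh variables\<close>

fun tbelow :: "nat \<Rightarrow> tm \<Rightarrow> bool" where
  "tbelow n (Var i) = (i < n)"
| "tbelow n Zero = True"
| "tbelow n (Succ t) = tbelow n t"
| "tbelow n (Add s t) = (tbelow n s \<and> tbelow n t)"
| "tbelow n (Mult s t) = (tbelow n s \<and> tbelow n t)"

lemma tbelow_Suc [simp]: "tbelow n t \<Longrightarrow> tbelow (Suc n) t"
  by (induction t) auto

lemma val_upd_fresh [simp]: "tbelow n t \<Longrightarrow> val M (e(n := a)) t = val M e t"
  by (induction t) auto

lemma tbelow_num [simp]: "tbelow n (num k)"
  by (induction k) auto

section \<open>Definability with parameters\<close>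

fun rename_tm :: "(nat \<Rightarrow> nat) \<Rightarrow> tm \<Rightarrow> tm" where
  "rename_tm \<sigma> (Var i) = Var (\<sigma> i)"
| "rename_tm \<sigma> Zero = Zero"
| "rename_tm \<sigma> (Succ t) = Succ (rename_tm \<sigma> t)"
| "rename_tm \<sigma> (Add s t) = Add (rename_tm \<sigma> s) (rename_tm \<sigma> t)"
| "rename_tm \<sigma> (Mult s t) = Mult (rename_tm \<sigma> s) (rename_tm \<sigma> t)"

fun rename_fm :: "(nat \<Rightarrow> nat) \<Rightarrow> fm \<Rightarrow> fm" where
  "rename_fm \<sigma> (Eq s t) = Eq (rename_tm \<sigma> s) (rename_tm \<sigma> t)"
| "rename_fm \<sigma> (Tr t) = Tr (rename_tm \<sigma> t)"
| "rename_fm \<sigma> (Neg p) = Neg (rename_fm \<sigma> p)"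
| "rename_fm \<sigma> (Or p q) = Or (rename_fm \<sigma> p) (rename_fm \<sigma> q)"
| "rename_fm \<sigma> (Ex v p) = Ex (\<sigma> v) (rename_fm \<sigma> p)"

lemma val_rename: "val M e (rename_tm \<sigma> t) = val M (e \<circ> \<sigma>) t"
  by (induction t) auto

text \<open>Bound variables are renamed along with free ones, so that an injective renaming cannot
  capture a variable.\<close>

lemma sat_rename:
  "inj \<sigma> \<Longrightarrow> sat M T e (rename_fm \<sigma> p) = sat M T (e \<circ> \<sigma>) p"
proof (induction p arbitrary: e)
  case (Ex v p)
  have "e(\<sigma> v := a) \<circ> \<sigma> = (e \<circ> \<sigma>)(v := a)" for a
    using Ex.prems by (auto simp: fun_eq_iff inj_eq)
  then show ?case by (simp only: rename_fm.simps sat.simps Ex.IH[OF Ex.prems])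
qed (simp_all add: val_rename)

lemma arithmetical_rename [simp]: "arithmetical (rename_fm \<sigma> p) = arithmetical p"
  by (induction p) auto

text \<open>Definability is to allow parameters. Even variables take their values from \<open>e\<close>, odd ones hold the
  parameters \<open>p\<close>. The parameters of two formulae can then be merged by renaming odd variables only.\<close>

definition join :: "(nat \<Rightarrow> 'a) \<Rightarrow> (nat \<Rightarrow> 'a) \<Rightarrow> nat \<Rightarrow> 'a" where
  "join e p i = (if even i then e (i div 2) else p (i div 2))"

lemma join_upd: "(join e p)(2 * n := a) = join (e(n := a)) p"
  by (auto simp: fun_eq_iff join_def)

lemma join_simps [simp]: "join e p (2 * i) = e i" "join e p (Suc (2 * i)) = p i"
  "join e p (Suc 0) = p 0"
  by (auto simp: join_def)

definition supported :: "nat \<Rightarrow> ((nat \<Rightarrow> 'a) \<Rightarrow> 'b) \<Rightarrow> bool" where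
  "supported n f \<longleftrightarrow> (\<forall>e e'. (\<forall>i<n. e i = e' i) \<longrightarrow> f e = f e')"

lemma supportedD: "supported n f \<Longrightarrow> (\<And>i. i < n \<Longrightarrow> e i = e' i) \<Longrightarrow> f e = f e'"
  by (auto simp: supported_def)

lemma supported_upd: "supported n f \<Longrightarrow> n \<le> m \<Longrightarrow> f (e(m := a)) = f e"
  by (rule supportedD) auto

lemma arg_cong3: "a = a' \<Longrightarrow> b = b' \<Longrightarrow> c = c' \<Longrightarrow> f a b c = f a' b' c'"
  by simp

lemma supported_map2:
  "supported n f \<Longrightarrow> supported n g \<Longrightarrow> supported n (\<lambda>e. h (f e) (g e))"
  unfolding supported_def by metis

lemma supported_var: "i < n \<Longrightarrow> supported n (\<lambda>e. e i)"
  and supported_const: "supported n (\<lambda>e. c)"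
  by (simp_all add: supported_def)

locale pa =
  fixes M :: "'a pa_structure"
  assumes PA_model: "PA_model M"
begin

text \<open>Relations are predicates on assignments rather than on tuples: one set of closure
  rules then serves all arities, and a quantifier refers to a variable by its index.\<close>

definition pdef :: "((nat \<Rightarrow> 'a) \<Rightarrow> bool) \<Rightarrow> bool" where
  "pdef P \<longleftrightarrow> (\<exists>\<phi> p. arithmetical \<phi> \<and> (\<forall>e. P e = sat M {} (join e p) \<phi>))"

lemma pdef_Not: assumes "pdef P" shows "pdef (\<lambda>e. \<not> P e)"
proof -
  obtain \<phi> p where "arithmetical \<phi>" "\<forall>e. P e = sat M {} (join e p) \<phi>"
    using assms by (auto simp: pdef_def)
  then show ?thesis unfolding pdef_def
    by (intro exI[of _ "Neg \<phi>"] exI[of _ p]) auto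
qed

text \<open>The parameters \<open>p\<close> and \<open>q\<close> are interleaved in turn: the \<open>i\<close>-th parameter of the first formula
  becomes number \<open>2 * i\<close> and that of the second one number \<open>2 * i + 1\<close>.\<close>

lemma pdef_or: assumes "pdef P" "pdef Q" shows "pdef (\<lambda>e. P e \<or> Q e)"
proof -
  obtain \<phi> p where 1: "arithmetical \<phi>" "\<forall>e. P e = sat M {} (join e p) \<phi>"
    using assms(1) by (auto simp: pdef_def)
  obtain \<psi> q where 2: "arithmetical \<psi>" "\<forall>e. Q e = sat M {} (join e q) \<psi>"
    using assms(2) by (auto simp: pdef_def)
  define \<sigma> where "\<sigma> i = (if even i then i else Suc (2 * (i - 1)))" for i :: nat
  define \<tau> where "\<tau> i = (if even i then i else Suc (2 * i))" for i :: nat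
  have "x = y" if "\<sigma> x = \<sigma> y \<or> \<tau> x = \<tau> y" for x y
  proof -
    have "even x = even y" using that unfolding \<sigma>_def \<tau>_def by (auto split: if_splits)
    then show ?thesis using that by (cases "even x") (auto simp: \<sigma>_def \<tau>_def elim!: oddE)
  qed
  then have "inj \<sigma>" "inj \<tau>" by (auto intro: injI)
  moreover have "(join e (join p q) \<circ> \<sigma>) i = join e p i"
    "(join e (join p q) \<circ> \<tau>) i = join e q i" for e i
    by (cases "even i"; auto simp: \<sigma>_def \<tau>_def elim!: evenE oddE)+
  then have "join e (join p q) \<circ> \<sigma> = join e p" "join e (join p q) \<circ> \<tau> = join e q" for e
    by auto
  ultimately show ?thesis unfolding pdef_def using 1 2
    by (intro exI[of _ "Or (rename_fm \<sigma> \<phi>) (rename_fm \<tau> \<psi>)"] exI[of _ "join p q"])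
      (auto simp: sat_rename)
qed

lemma pdef_ex:
  assumes "pdef (\<lambda>e. P (e n) e)" and "\<And>x y e. P x (e(n := y)) = P x e"
  shows "pdef (\<lambda>e. \<exists>x. P x e)"
proof -
  obtain \<phi> p where "arithmetical \<phi>" "\<forall>e. P (e n) e = sat M {} (join e p) \<phi>"
    using assms by (auto simp: pdef_def)
  then have "arithmetical (Ex (2 * n) \<phi>)"
    "\<forall>e. (\<exists>x. P x e) = sat M {} (join e p) (Ex (2 * n) \<phi>)"
    using assms(2) by (simp_all add: join_upd flip: \<open>\<forall>e. P (e n) e = _\<close>)
  then show ?thesis unfolding pdef_def by blast
qed

lemma pdef_perm:
  assumes "pdef P" "inj \<pi>" shows "pdef (\<lambda>e. P (e \<circ> \<pi>))"
proof -
  obtain \<phi> p where 1: "arithmetical \<phi>" "\<forall>e. P e = sat M {} (join e p) \<phi>"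
    using assms by (auto simp: pdef_def)
  define \<sigma> where "\<sigma> i = (if even i then 2 * \<pi> (i div 2) else i)" for i :: nat
  have "inj \<sigma>"
  proof (rule injI)
    fix x y assume *: "\<sigma> x = \<sigma> y"
    then have "even x = even y" unfolding \<sigma>_def by presburger
    then show "x = y" using * assms(2)
      by (cases "even x") (auto simp: \<sigma>_def inj_eq elim!: evenE)
  qed
  moreover have "join e p \<circ> \<sigma> = join (e \<circ> \<pi>) p" for e
    by (auto simp: fun_eq_iff join_def \<sigma>_def)
  ultimately show ?thesis unfolding pdef_def using 1
    by (intro exI[of _ "rename_fm \<sigma> \<phi>"] exI[of _ p]) (auto simp: sat_rename)
qed

lemma pdef_formula:
  assumes "arithmetical \<phi>" "\<And>e. P e = sat M {} (join e p) \<phi>"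
  shows "pdef P"
  using assms by (auto simp: pdef_def)

lemma pdef_eq: "pdef (\<lambda>e. e i = e j)"
  by (rule pdef_formula[of "Eq (Var (2*i)) (Var (2*j))"]) auto
lemma pdef_const: "pdef (\<lambda>e. c = e j)"
  by (rule pdef_formula[of "Eq (Var (2*j)) (Var 1)" _ "\<lambda>_. c"]) auto
lemma pdef_succ: "pdef (\<lambda>e. succM M (e i) = e j)"
  by (rule pdef_formula[of "Eq (Succ (Var (2*i))) (Var (2*j))"]) auto
lemma pdef_add: "pdef (\<lambda>e. addM M (e i) (e k) = e j)"
  by (rule pdef_formula[of "Eq (Add (Var (2*i)) (Var (2*k))) (Var (2*j))"]) auto
lemma pdef_mult: "pdef (\<lambda>e. multM M (e i) (e k) = e j)"
  by (rule pdef_formula[of "Eq (Mult (Var (2*i)) (Var (2*k))) (Var (2*j))"]) auto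

text \<open>The level \<open>n\<close> bounds the variables that matter, so that variable \<open>n\<close> is free to be quantified.\<close>

definition dfn :: "nat \<Rightarrow> ((nat \<Rightarrow> 'a) \<Rightarrow> bool) \<Rightarrow> bool" where
  "dfn n P \<longleftrightarrow> supported n P \<and> pdef P"

text \<open>A function is given by its graph; since it depends on variables below \<open>n\<close> only, its value can be
  placed in variable \<open>n\<close>.\<close>

definition dfn_fun :: "nat \<Rightarrow> ((nat \<Rightarrow> 'a) \<Rightarrow> 'a) \<Rightarrow> bool" where
  "dfn_fun n f \<longleftrightarrow> supported n f \<and> pdef (\<lambda>e. f e = e n)"

named_theorems dfn_intros

text \<open>Interchanging two variables that the function does not depend on moves its value from one to
  the other.\<close>

lemma dfn_fun_graph:
  assumes "dfn_fun n f" "n \<le> m" shows "pdef (\<lambda>e. f e = e m)"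
proof -
  define \<pi> where "\<pi> i = (if i = n then m else if i = m then n else i)" for i
  have "inj \<pi>" by (auto simp: inj_def \<pi>_def)
  moreover have "pdef (\<lambda>e. f e = e n)" "supported n f" using assms by (auto simp: dfn_fun_def)
  moreover have "f (e \<circ> \<pi>) = f e" for e
    by (rule supportedD[OF \<open>supported n f\<close>]) (use assms in \<open>auto simp: \<pi>_def\<close>)
  ultimately show ?thesis using pdef_perm[of "\<lambda>e. f e = e n" \<pi>]
    by (simp add: \<pi>_def)
qed

lemma supported_mono: "supported n f \<Longrightarrow> n \<le> m \<Longrightarrow> supported m f"
  unfolding supported_def by auto

lemma dfn_fun_mono: "dfn_fun n f \<Longrightarrow> n \<le> m \<Longrightarrow> dfn_fun m f"
  using dfn_fun_graph[of n f m] supported_mono[of n f m] by (simp add: dfn_fun_def)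

lemma dfn_Not [dfn_intros]: "dfn n P \<Longrightarrow> dfn n (\<lambda>e. \<not> P e)"
  unfolding dfn_def using pdef_Not supported_map2[of n P P "\<lambda>x y. \<not> x"] by simp

lemma dfn_or [dfn_intros]: "dfn n P \<Longrightarrow> dfn n Q \<Longrightarrow> dfn n (\<lambda>e. P e \<or> Q e)"
  unfolding dfn_def using pdef_or supported_map2[of n P Q "(\<or>)"] by simp

lemma dfn_and [dfn_intros]: "dfn n P \<Longrightarrow> dfn n Q \<Longrightarrow> dfn n (\<lambda>e. P e \<and> Q e)"
proof -
  assume "dfn n P" "dfn n Q"
  then have "dfn n (\<lambda>e. \<not> (\<not> P e \<or> \<not> Q e))" by (intro dfn_Not dfn_or)
  then show ?thesis by simp
qed

lemma dfn_imp [dfn_intros]: "dfn n P \<Longrightarrow> dfn n Q \<Longrightarrow> dfn n (\<lambda>e. P e \<longrightarrow> Q e)"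
proof -
  assume "dfn n P" "dfn n Q"
  then have "dfn n (\<lambda>e. \<not> P e \<or> Q e)" by (intro dfn_Not dfn_or)
  then show ?thesis by (simp only: imp_conv_disj)
qed

lemma dfn_iff [dfn_intros]: "dfn n P \<Longrightarrow> dfn n Q \<Longrightarrow> dfn n (\<lambda>e. P e \<longleftrightarrow> Q e)"
proof -
  assume "dfn n P" "dfn n Q"
  then have "dfn n (\<lambda>e. (P e \<longrightarrow> Q e) \<and> (Q e \<longrightarrow> P e))" by (intro dfn_and dfn_imp)
  moreover have "(\<lambda>e. (P e \<longrightarrow> Q e) \<and> (Q e \<longrightarrow> P e)) = (\<lambda>e. P e \<longleftrightarrow> Q e)" by blast
  ultimately show ?thesis by simp
qed

text \<open>The second premise says that \<open>P x\<close> does not read variable \<open>n\<close>, which is about to hold the witness.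
  For a concrete \<open>P\<close>, simplification decides it.\<close>

lemma dfn_ex [dfn_intros]:
  assumes "dfn (Suc n) (\<lambda>e. P (e n) e)" and *: "\<And>x y e. P x (e(n := y)) = P x e"
  shows "dfn n (\<lambda>e. \<exists>x. P x e)"
  unfolding dfn_def
proof
  have s: "supported (Suc n) (\<lambda>e. P (e n) e)" using assms by (auto simp: dfn_def)
  show "supported n (\<lambda>e. \<exists>x. P x e)" unfolding supported_def
  proof (intro allI impI)
    fix e e' :: "nat \<Rightarrow> 'a" assume 1: "\<forall>i<n. e i = e' i"
    have "P x e = P x e'" for x
    proof -
      have "P ((e(n := x)) n) (e(n := x)) = P ((e'(n := x)) n) (e'(n := x))"
        by (rule supportedD[OF s]) (use 1 in \<open>auto simp: less_Suc_eq\<close>)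
      then show ?thesis by (simp add: *)
    qed
    then show "(\<exists>x. P x e) = (\<exists>x. P x e')" by simp
  qed
  show "pdef (\<lambda>e. \<exists>x. P x e)"
    using assms by (auto simp: dfn_def intro: pdef_ex[where n = n])
qed

lemma dfn_all [dfn_intros]:
  assumes "dfn (Suc n) (\<lambda>e. P (e n) e)" and *: "\<And>x y e. P x (e(n := y)) = P x e"
  shows "dfn n (\<lambda>e. \<forall>x. P x e)"
proof -
  have "dfn n (\<lambda>e. \<not> (\<exists>x. \<not> P x e))"
    by (rule dfn_Not, rule dfn_ex, rule dfn_Not) (use assms in simp_all)
  then show ?thesis by simp
qed

lemma dfn_const: "dfn n (\<lambda>e. b)"
proof -
  have "pdef (\<lambda>e. True)" by (rule pdef_formula[of "Eq Zero Zero"]) auto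
  moreover have "pdef (\<lambda>e. False)" by (rule pdef_formula[of "Neg (Eq Zero Zero)"]) auto
  ultimately show ?thesis by (cases b) (simp_all add: dfn_def supported_const)
qed

text \<open>Substitution of a definable function without substitution in formulae: \<open>Q (f e)\<close> is
  written as \<open>\<exists>x. f e = x \<and> Q x\<close>.\<close>

lemma dfn_comp:
  assumes Q: "dfn (Suc n) (\<lambda>e. Q (e n) e)" "\<And>x y e. Q x (e(n := y)) = Q x e"
    and f: "dfn_fun n f"
  shows "dfn n (\<lambda>e. Q (f e) e)"
proof -
  have s: "supported n f" using f by (simp add: dfn_fun_def)
  have "dfn n (\<lambda>e. \<exists>x. f e = x \<and> Q x e)"
  proof (rule dfn_ex)
    have "dfn (Suc n) (\<lambda>e. f e = e n)"
      using f supported_map2[OF supported_mono[OF s] supported_var[OF lessI], where h = "(=)"]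
      by (simp add: dfn_def dfn_fun_def)
    then show "dfn (Suc n) (\<lambda>e. f e = e n \<and> Q (e n) e)"
      using Q(1) by (rule dfn_and)
  qed (simp add: supported_upd[OF s] Q(2))
  then show ?thesis by simp
qed

lemma dfn_fun_upd: "dfn_fun n f \<Longrightarrow> n \<le> m \<Longrightarrow> f (e(m := a)) = f e"
  using supported_upd[of n f m e a] by (simp add: dfn_fun_def)

lemma dfn_comp1:
  assumes P: "\<And>i. pdef (\<lambda>e. P (e i))" and f: "dfn_fun n f"
  shows "dfn n (\<lambda>e. P (f e))"
  by (rule dfn_comp[where Q = "\<lambda>x e. P x", OF _ _ f]) (auto simp: dfn_def supported_def P)

lemma dfn_comp2:
  assumes P: "\<And>i j. pdef (\<lambda>e. P (e i) (e j))"
    and f: "dfn_fun n f" "dfn_fun n g"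
  shows "dfn n (\<lambda>e. P (f e) (g e))"
proof -
  note fresh = dfn_fun_upd[OF f(1)] dfn_fun_upd[OF f(2)]
  have "dfn (Suc n) (\<lambda>e. P (e n) (g e))"
    by (rule dfn_comp[where Q = "\<lambda>x e. P (e n) x",
          OF _ _ dfn_fun_mono[OF f(2) le_SucI[OF le_refl]]])
      (auto simp: dfn_def supported_def P)
  then show ?thesis
    by (rule dfn_comp[where Q = "\<lambda>x e. P x (g e)", OF _ _ f(1)])
      (simp only: fresh le_refl)
qed

lemma dfn_comp3:
  assumes P: "\<And>i j k. pdef (\<lambda>e. P (e i) (e j) (e k))"
    and f: "dfn_fun n f" "dfn_fun n g" "dfn_fun n h"
  shows "dfn n (\<lambda>e. P (f e) (g e) (h e))"
proof -
  note fresh = dfn_fun_upd[OF f(1)] dfn_fun_upd[OF f(2)] dfn_fun_upd[OF f(3)]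
  have "dfn (Suc (Suc n)) (\<lambda>e. P (e n) (e (Suc n)) (h e))"
    by (rule dfn_comp[where Q = "\<lambda>x e. P (e n) (e (Suc n)) x",
          OF _ _ dfn_fun_mono[OF f(3) le_SucI[OF le_SucI[OF le_refl]]]])
      (auto simp: dfn_def supported_def P)
  then have "dfn (Suc n) (\<lambda>e. P (e n) (g e) (h e))"
    by (rule dfn_comp[where Q = "\<lambda>x e. P (e n) x (h e)",
          OF _ _ dfn_fun_mono[OF f(2) le_SucI[OF le_refl]]])
      (simp only: fresh le_refl le_SucI, simp)
  then show ?thesis
    by (rule dfn_comp[where Q = "\<lambda>x e. P x (g e) (h e)", OF _ _ f(1)])
      (simp only: fresh le_refl)
qed

lemma dfn_comp4:
  assumes P: "\<And>i j k l. pdef (\<lambda>e. P (e i) (e j) (e k) (e l))"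
    and f: "dfn_fun n f" "dfn_fun n g" "dfn_fun n h" "dfn_fun n u"
  shows "dfn n (\<lambda>e. P (f e) (g e) (h e) (u e))"
proof -
  note fresh = dfn_fun_upd[OF f(1)] dfn_fun_upd[OF f(2)] dfn_fun_upd[OF f(3)] dfn_fun_upd[OF f(4)]
  have "dfn (Suc (Suc (Suc n))) (\<lambda>e. P (e n) (e (Suc n)) (e (Suc (Suc n))) (u e))"
    by (rule dfn_comp[where Q = "\<lambda>x e. P (e n) (e (Suc n)) (e (Suc (Suc n))) x",
          OF _ _ dfn_fun_mono[OF f(4) le_SucI[OF le_SucI[OF le_SucI[OF le_refl]]]]])
      (auto simp: dfn_def supported_def P)
  then have "dfn (Suc (Suc n)) (\<lambda>e. P (e n) (e (Suc n)) (h e) (u e))"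
    by (rule dfn_comp[where Q = "\<lambda>x e. P (e n) (e (Suc n)) x (u e)",
          OF _ _ dfn_fun_mono[OF f(3) le_SucI[OF le_SucI[OF le_refl]]]])
      (simp only: fresh le_refl le_SucI, simp)
  then have "dfn (Suc n) (\<lambda>e. P (e n) (g e) (h e) (u e))"
    by (rule dfn_comp[where Q = "\<lambda>x e. P (e n) x (h e) (u e)",
          OF _ _ dfn_fun_mono[OF f(2) le_SucI[OF le_refl]]])
      (simp only: fresh le_refl le_SucI, simp)
  then show ?thesis
    by (rule dfn_comp[where Q = "\<lambda>x e. P x (g e) (h e) (u e)", OF _ _ f(1)])
      (simp only: fresh le_refl)
qed

lemma dfn_fun_var [dfn_intros]: "i < n \<Longrightarrow> dfn_fun n (\<lambda>e. e i)"
  by (simp add: dfn_fun_def supported_var pdef_eq)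

lemma dfn_fun_param [dfn_intros]: "dfn_fun n (\<lambda>e. c)"
  by (simp add: dfn_fun_def supported_const pdef_const)

lemma dfn_eq [dfn_intros]: "dfn_fun n f \<Longrightarrow> dfn_fun n g \<Longrightarrow> dfn n (\<lambda>e. f e = g e)"
  by (rule dfn_comp2[where P = "(=)"]) (rule pdef_eq)

lemma dfn_fun_comp1:
  assumes "\<And>i j. pdef (\<lambda>e. g (e i) = e j)" "dfn_fun n f"
  shows "dfn_fun n (\<lambda>e. g (f e))"
proof -
  have "dfn (Suc n) (\<lambda>e. g (f e) = e n)"
    by (rule dfn_comp2[where P = "\<lambda>x y. g x = y"])
      (use assms in \<open>simp_all add: dfn_fun_mono[of n] dfn_fun_var\<close>)
  moreover have "supported n (\<lambda>e. g (f e))"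
    using assms by (fastforce simp: dfn_fun_def supported_def intro!: arg_cong[where f = g])
  ultimately show ?thesis by (simp add: dfn_fun_def dfn_def)
qed

lemma dfn_fun_comp2:
  assumes "\<And>i j k. pdef (\<lambda>e. g (e i) (e j) = e k)" "dfn_fun n f" "dfn_fun n h"
  shows "dfn_fun n (\<lambda>e. g (f e) (h e))"
proof -
  have "dfn (Suc n) (\<lambda>e. g (f e) (h e) = e n)"
    by (rule dfn_comp3[where P = "\<lambda>x y z. g x y = z"])
      (use assms in \<open>simp_all add: dfn_fun_mono[of n] dfn_fun_var\<close>)
  moreover have "supported n (\<lambda>e. g (f e) (h e))"
    using assms by (fastforce simp: dfn_fun_def supported_def intro!: arg_cong2[where f = g])
  ultimately show ?thesis by (simp add: dfn_fun_def dfn_def)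
qed

lemma dfn_fun_comp3:
  assumes "\<And>i j k l. pdef (\<lambda>e. g (e i) (e j) (e k) = e l)" "dfn_fun n f" "dfn_fun n h" "dfn_fun n u"
  shows "dfn_fun n (\<lambda>e. g (f e) (h e) (u e))"
proof -
  have "dfn (Suc n) (\<lambda>e. g (f e) (h e) (u e) = e n)"
    by (rule dfn_comp4[where P = "\<lambda>x y z w. g x y z = w"])
      (use assms in \<open>simp_all add: dfn_fun_mono[of n] dfn_fun_var\<close>)
  moreover have "supported n (\<lambda>e. g (f e) (h e) (u e))"
    using assms by (fastforce simp: dfn_fun_def supported_def intro!: arg_cong3[where f = g])
  ultimately show ?thesis by (simp add: dfn_fun_def dfn_def)
qed

lemmas dfn_fun_succ [dfn_intros] = dfn_fun_comp1[where g = "succM M", OF pdef_succ]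
lemmas dfn_fun_add [dfn_intros] = dfn_fun_comp2[where g = "addM M", OF pdef_add]
lemmas dfn_fun_mult [dfn_intros] = dfn_fun_comp2[where g = "multM M", OF pdef_mult]

section \<open>The induction scheme\<close>

lemma val_subst:
  "(\<And>u a e. u \<noteq> v \<Longrightarrow> val M (e(u := a)) r = val M e r) \<Longrightarrow>
   val M e (subst_tm v r t) = val M (e(v := val M e r)) t"
  by (induction t) auto

lemma sat_subst:
  assumes r: "\<And>u a e. u \<noteq> v \<Longrightarrow> val M (e(u := a)) r = val M e r"
  shows "sat M T e (subst_fm v r p) = sat M T (e(v := val M e r)) p"
proof (induction p arbitrary: e)
  case (Ex u p)
  have "val M (e(u := a)) r = val M e r" if "u \<noteq> v" for a
    by (rule r[OF that])
  then show ?case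
    by (cases "u = v") (simp_all only: Ex.IH subst_fm.simps sat.simps fun_upd_twist if_True if_False
      simp_thms fun_upd_upd)
qed (simp_all add: val_subst[OF r])

lemma sat_subst_Zero: "sat M T e (subst_fm v Zero p) = sat M T (e(v := zeroM M)) p"
proof -
  have "sat M T e (subst_fm v Zero p) = sat M T (e(v := val M e Zero)) p"
    by (rule sat_subst) (simp only: val.simps)
  then show ?thesis by (simp only: val.simps)
qed

lemma sat_subst_Succ:
  "sat M T e (subst_fm v (Succ (Var v)) p) = sat M T (e(v := succM M (e v))) p"
proof -
  have "sat M T e (subst_fm v (Succ (Var v)) p) = sat M T (e(v := val M e (Succ (Var v)))) p"
    by (rule sat_subst) simp
  then show ?thesis by (simp only: val.simps)
qed

lemma sat_connectives [simp]:
  "sat M T e (And p q) \<longleftrightarrow> sat M T e p \<and> sat M T e q"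
  "sat M T e (Imp p q) \<longleftrightarrow> (sat M T e p \<longrightarrow> sat M T e q)"
  "sat M T e (All v p) \<longleftrightarrow> (\<forall>a. sat M T (e(v := a)) p)"
  by (auto simp: And_def Imp_def All_def)

lemma arithmetical_connectives [simp]:
  "arithmetical (And p q) \<longleftrightarrow> arithmetical p \<and> arithmetical q"
  "arithmetical (Imp p q) \<longleftrightarrow> arithmetical p \<and> arithmetical q"
  "arithmetical (All v p) \<longleftrightarrow> arithmetical p"
  by (auto simp: And_def Imp_def All_def)

lemma PA_sat: "p \<in> PA \<Longrightarrow> sat M {} e p"
  using PA_model by (auto simp: PA_model_def models_def)

lemma induction_axiom_in_PA: "arithmetical p \<Longrightarrow> induction_axiom v p \<in> PA"
  unfolding PA_def by (rule UnI2) blast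

text \<open>The induction scheme as a proof rule. Its first premise, that the property be definable in
  the model, is proved by the rules collected in \<open>dfn_intros\<close>; parameters need no mention, as they are
  constant functions.\<close>

lemma pa_induct:
  assumes d: "dfn (Suc 0) (\<lambda>e. P (e 0))"
    and z: "P (zeroM M)" and s: "\<And>x. P x \<Longrightarrow> P (succM M x)"
  shows "P x"
proof -
  obtain \<phi> p where 1: "arithmetical \<phi>" and "\<forall>e. P (e 0) = sat M {} (join e p) \<phi>"
    using d by (auto simp: pdef_def dfn_def)
  moreover define e where "e = join (\<lambda>_. zeroM M) p"
  ultimately have 2: "P x = sat M {} (e(0 := x)) \<phi>" for x
    using join_upd[of "\<lambda>_. zeroM M" p 0] by (metis fun_upd_same mult_0_right)
  have ax: "sat M {} e (induction_axiom 0 \<phi>)"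
    by (rule PA_sat) (rule induction_axiom_in_PA[OF 1])
  have *: "P (zeroM M) \<and> (\<forall>x. P x \<longrightarrow> P (succM M x)) \<longrightarrow> (\<forall>x. P x)"
    by (rule ax[unfolded induction_axiom_def sat_connectives sat_subst_Zero sat_subst_Succ
        fun_upd_upd fun_upd_same, folded 2])
  have "\<forall>x. P x"
    by (rule mp[OF *], rule conjI, rule z, intro allI impI, erule s)
  then show ?thesis ..
qed

section \<open>Arithmetic in the model\<close>

declare dfn_const [dfn_intros]

abbreviation zero_M ("\<zero>") where "\<zero> \<equiv> zeroM M"
abbreviation succ_M ("S") where "S \<equiv> succM M"
abbreviation plus_M (infixl "\<oplus>" 65) where "x \<oplus> y \<equiv> addM M x y"
abbreviation times_M (infixl "\<otimes>" 70) where "x \<otimes> y \<equiv> multM M x y"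

lemma succ_neq_zero [simp]: "S x \<noteq> \<zero>" "\<zero> \<noteq> S x"
  using PA_sat[of "Neg (Eq (Succ (Var 0)) Zero)" "\<lambda>_. x"] by (simp_all add: PA_def)

lemma succ_inj [simp]: "S x = S y \<longleftrightarrow> x = y"
  using PA_sat[of "Imp (Eq (Succ (Var 0)) (Succ (Var 1))) (Eq (Var 0) (Var 1))"
      "\<lambda>i. if i = 0 then x else y"]
  by (auto simp: PA_def)

lemma add_zero [simp]: "x \<oplus> \<zero> = x"
  using PA_sat[of "Eq (Add (Var 0) Zero) (Var 0)" "\<lambda>_. x"] by (simp add: PA_def)

lemma mult_zero [simp]: "x \<otimes> \<zero> = \<zero>"
  using PA_sat[of "Eq (Mult (Var 0) Zero) Zero" "\<lambda>_. x"] by (simp add: PA_def)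

lemma add_succ [simp]: "x \<oplus> S y = S (x \<oplus> y)"
  using PA_sat[of "Eq (Add (Var 0) (Succ (Var 1))) (Succ (Add (Var 0) (Var 1)))"
      "\<lambda>i. if i = 0 then x else y"]
  by (simp add: PA_def)

lemma mult_succ [simp]: "x \<otimes> S y = x \<otimes> y \<oplus> x"
  using PA_sat[of "Eq (Mult (Var 0) (Succ (Var 1))) (Add (Mult (Var 0) (Var 1)) (Var 0))"
      "\<lambda>i. if i = 0 then x else y"]
  by (simp add: PA_def)

lemma zero_add [simp]: "\<zero> \<oplus> x = x"
proof (induct x rule: pa_induct)
  case 1 show ?case by (intro dfn_intros; simp)
qed simp_all

lemma succ_add [simp]: "S x \<oplus> y = S (x \<oplus> y)"
proof (induct y rule: pa_induct)
  case 1 show ?case by (intro dfn_intros; simp)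
qed simp_all

lemma add_comm: "x \<oplus> y = y \<oplus> x"
proof (induct y rule: pa_induct)
  case 1 show ?case by (intro dfn_intros; simp)
qed simp_all

lemma add_assoc: "x \<oplus> y \<oplus> z = x \<oplus> (y \<oplus> z)"
proof (induct z rule: pa_induct)
  case 1 show ?case by (intro dfn_intros; simp)
qed simp_all

lemma add_left_comm: "x \<oplus> (y \<oplus> z) = y \<oplus> (x \<oplus> z)"
  by (metis add_assoc add_comm)

lemma zero_mult [simp]: "\<zero> \<otimes> x = \<zero>"
proof (induct x rule: pa_induct)
  case 1 show ?case by (intro dfn_intros; simp)
qed simp_all

lemma succ_mult [simp]: "S x \<otimes> y = x \<otimes> y \<oplus> y"
proof (induct y rule: pa_induct)
  case 1 show ?case by (intro dfn_intros; simp)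
next
  case (3 y) then show ?case by (simp add: add_assoc add_comm[of x y])
qed simp_all

lemma mult_comm: "x \<otimes> y = y \<otimes> x"
proof (induct y rule: pa_induct)
  case 1 show ?case by (intro dfn_intros; simp)
qed simp_all

lemma distrib_left: "x \<otimes> (y \<oplus> z) = x \<otimes> y \<oplus> x \<otimes> z"
proof (induct z rule: pa_induct)
  case 1 show ?case by (intro dfn_intros; simp)
qed (simp_all add: add_assoc)

lemma mult_assoc: "x \<otimes> y \<otimes> z = x \<otimes> (y \<otimes> z)"
proof (induct z rule: pa_induct)
  case 1 show ?case by (intro dfn_intros; simp)
qed (simp_all add: distrib_left)

lemma add_left_cancel [simp]: "x \<oplus> y = x \<oplus> z \<longleftrightarrow> y = z"
proof (induct x rule: pa_induct)
  case 1 show ?case by (intro dfn_intros; simp)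
qed simp_all

lemma zero_or_succ: "x = \<zero> \<or> (\<exists>y. x = S y)"
proof (induct x rule: pa_induct)
  case 1 show ?case by (intro dfn_intros; simp)
qed simp_all

lemma add_eq_zero [simp]: "x \<oplus> y = \<zero> \<longleftrightarrow> x = \<zero> \<and> y = \<zero>"
  using zero_or_succ[of x] zero_or_succ[of y] by auto

lemma mult_eq_zero: "x \<otimes> y = \<zero> \<longleftrightarrow> x = \<zero> \<or> y = \<zero>"
  using zero_or_succ[of x] zero_or_succ[of y] by auto

definition le_M (infix "\<preceq>" 50) where "x \<preceq> y \<longleftrightarrow> (\<exists>z. x \<oplus> z = y)"
definition less_M (infix "\<prec>" 50) where "x \<prec> y \<longleftrightarrow> (\<exists>z. x \<oplus> S z = y)"

text \<open>Truncated subtraction makes the model an ordered semidomain in the sense of the type classes.\<close>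

definition minus_M (infixl "\<ominus>" 65)
  where "x \<ominus> y = (if y \<preceq> x then THE z. y \<oplus> z = x else \<zero>)"

lemma le_total: "x \<preceq> y \<or> y \<preceq> x"
  unfolding le_M_def
proof (induct x rule: pa_induct)
  case 1 show ?case by (intro dfn_intros; simp)
next
  case (3 x)
  then show ?case
  proof
    assume "\<exists>z. x \<oplus> z = y"
    then obtain z where "x \<oplus> z = y" by blast
    then show ?thesis using zero_or_succ[of z] add_succ[of x] by (metis add_succ add_zero succ_add)
  qed (metis add_succ)
qed simp

lemma add_minus [simp]: "x \<oplus> y \<ominus> x = y"
  unfolding minus_M_def le_M_def by auto

lemma less_le: "x \<prec> y \<longleftrightarrow> x \<preceq> y \<and> x \<noteq> y"
proof
  assume "x \<prec> y"
  then obtain z where z: "y = x \<oplus> S z" by (auto simp: less_M_def)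
  then have "x \<oplus> S z \<noteq> x \<oplus> \<zero>" unfolding add_left_cancel by simp
  then show "x \<preceq> y \<and> x \<noteq> y" using z by (auto simp: le_M_def simp del: add_succ)
next
  assume "x \<preceq> y \<and> x \<noteq> y" then show "x \<prec> y"
    unfolding le_M_def less_M_def by (metis add_zero zero_or_succ)
qed

lemma le_antisym: "x \<preceq> y \<Longrightarrow> y \<preceq> x \<Longrightarrow> x = y"
proof -
  assume "x \<preceq> y" "y \<preceq> x"
  then obtain a b where "x \<oplus> a = y" "y \<oplus> b = x" by (auto simp: le_M_def)
  then have "x \<oplus> (a \<oplus> b) = x \<oplus> \<zero>" by (metis add_assoc add_zero)
  then have "a = \<zero>" by (simp only: add_left_cancel add_eq_zero)
  then show ?thesis using \<open>x \<oplus> a = y\<close> by simp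
qed

lemma le_minus: "y \<preceq> x \<Longrightarrow> x \<ominus> y \<oplus> y = x"
  by (metis add_minus add_comm le_M_def)

lemma minus_eq_zero: "\<not> y \<preceq> x \<Longrightarrow> x \<ominus> y = \<zero>"
  by (simp add: minus_M_def)

lemma le_iff_add: "x \<preceq> y \<longleftrightarrow> (\<exists>z. y = x \<oplus> z)"
  by (auto simp: le_M_def)

lemma minus_minus: "a \<ominus> b \<ominus> c = a \<ominus> (b \<oplus> c)"
proof (cases "b \<preceq> a")
  case True
  then obtain d where d: "a = b \<oplus> d" by (auto simp: le_iff_add)
  show ?thesis
  proof (cases "c \<preceq> d")
    case True
    then obtain f where "d = c \<oplus> f" by (auto simp: le_iff_add)
    then show ?thesis using add_minus[of "b \<oplus> c" f] by (simp add: d add_assoc)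
  next
    case False
    then have "\<not> b \<oplus> c \<preceq> a" by (auto simp: d le_iff_add add_assoc)
    then show ?thesis using False by (simp add: d minus_eq_zero)
  qed
next
  case False
  then have "\<not> b \<oplus> c \<preceq> a" by (auto simp: le_iff_add add_assoc)
  moreover have "\<zero> \<ominus> c = \<zero>"
  proof (cases "c \<preceq> \<zero>")
    case True
    then have "c = \<zero>" by (metis le_iff_add add_eq_zero)
    then show ?thesis using add_minus[of \<zero> \<zero>] by simp
  qed (rule minus_eq_zero)
  ultimately show ?thesis using False by (simp add: minus_eq_zero)
qed

lemma mult_minus: "a \<otimes> (b \<ominus> c) = a \<otimes> b \<ominus> a \<otimes> c"
proof (cases "c \<preceq> b")
  case True
  then show ?thesis by (auto simp: le_iff_add distrib_left)
next
  case False
  then obtain d where d: "c = b \<oplus> d" using le_total[of b c] unfolding le_iff_add by auto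
  show ?thesis
  proof (cases "a \<otimes> c \<preceq> a \<otimes> b")
    case True
    moreover have "a \<otimes> b \<preceq> a \<otimes> c" by (auto simp: d distrib_left le_iff_add)
    ultimately have "a \<otimes> c = a \<otimes> b" by (rule le_antisym)
    then show ?thesis using add_minus[of "a \<otimes> b" \<zero>] False by (simp add: minus_eq_zero)
  qed (simp add: minus_eq_zero False)
qed

lemma mult_strict_left_mono: "a \<prec> b \<Longrightarrow> \<zero> \<prec> c \<Longrightarrow> c \<otimes> a \<prec> c \<otimes> b"
proof -
  assume "a \<prec> b" "\<zero> \<prec> c"
  then obtain z w where "b = a \<oplus> S z" "c = S w" unfolding less_M_def zero_add by metis
  then have "c \<otimes> b = c \<otimes> a \<oplus> S (c \<otimes> z \<oplus> w)"
    by (simp add: distrib_left add_assoc add_left_comm add_comm)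
  then show ?thesis unfolding less_M_def by metis
qed

lemma le_trans: "a \<preceq> b \<Longrightarrow> b \<preceq> c \<Longrightarrow> a \<preceq> c"
  by (auto simp: le_iff_add add_assoc)

lemma le_refl_M: "a \<preceq> a"
  unfolding le_iff_add by (metis add_zero)

lemma distrib_right: "(a \<oplus> b) \<otimes> c = a \<otimes> c \<oplus> b \<otimes> c"
  by (metis distrib_left mult_comm)

lemma less_le_not_le: "x \<prec> y \<longleftrightarrow> x \<preceq> y \<and> \<not> y \<preceq> x"
  using less_le le_antisym le_refl_M by metis

lemma add_mono_left: "a \<preceq> b \<Longrightarrow> c \<oplus> a \<preceq> c \<oplus> b"
  by (auto simp: le_iff_add add_assoc)

lemma less_succ_iff: "x \<prec> S y \<longleftrightarrow> x \<preceq> y"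
  unfolding less_M_def le_M_def by simp

lemma zero_le: "\<zero> \<preceq> x"
  by (simp add: le_M_def)

sublocale N: linordered_semidom
  where plus = "addM M" and zero = "zeroM M" and times = "multM M" and one = "succM M (zeroM M)"
    and minus = minus_M and less_eq = le_M and less = less_M
  by (unfold_locales; (fact add_assoc add_comm add_minus minus_minus le_refl_M le_total mult_assoc
        mult_comm mult_minus mult_strict_left_mono less_le_not_le le_trans le_antisym add_mono_left
        distrib_left distrib_right le_minus zero_add mult_zero zero_mult succ_neq_zero)?;
      (simp add: less_succ_iff zero_le mult_eq_zero)?)

lemma not_less_zero [simp]: "\<not> x \<prec> \<zero>"
  using zero_le N.not_less by blast

lemma less_succ [simp]: "x \<prec> S x"
  by (simp add: less_succ_iff)

lemma succ_le_iff: "S x \<preceq> y \<longleftrightarrow> x \<prec> y"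
  unfolding less_M_def le_M_def by simp

lemma succ_less_succ [simp]: "S x \<prec> S y \<longleftrightarrow> x \<prec> y"
  by (simp add: less_succ_iff succ_le_iff)

lemma dfn_pdef: "(\<And>n. \<lbrakk>i < n; j < n; k < n; l < n\<rbrakk> \<Longrightarrow> dfn n P) \<Longrightarrow> pdef P"
proof -
  assume *: "\<And>n. \<lbrakk>i < n; j < n; k < n; l < n\<rbrakk> \<Longrightarrow> dfn n P"
  have "dfn (Suc (i + j + k + l)) P" by (rule *) simp_all
  then show ?thesis by (simp add: dfn_def)
qed

lemma dfn_unary:
  assumes "dfn (Suc 0) (\<lambda>e. P (e 0))" "dfn_fun n f" shows "dfn n (\<lambda>e. P (f e))"
proof (rule dfn_comp1[OF _ assms(2)])
  fix i :: nat
  define \<pi> where "\<pi> j = (if j = 0 then i else if j = i then 0 else j)" for j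
  have "inj \<pi>" by (auto simp: inj_def \<pi>_def)
  then show "pdef (\<lambda>e. P (e i))"
    using pdef_perm[of "\<lambda>e. P (e 0)" \<pi>] assms(1) by (simp add: dfn_def \<pi>_def)
qed

lemma pdef_less: "pdef (\<lambda>e. e i \<prec> e j)"
  unfolding less_M_def by (rule dfn_pdef[of i j i j], intro dfn_intros; simp)

lemma pdef_le: "pdef (\<lambda>e. e i \<preceq> e j)"
  unfolding le_M_def by (rule dfn_pdef[of i j i j], intro dfn_intros; simp)

lemmas dfn_less [dfn_intros] = dfn_comp2[where P = less_M, OF pdef_less]
lemmas dfn_le [dfn_intros] = dfn_comp2[where P = le_M, OF pdef_le]

lemma less_induct_M:
  assumes P: "dfn (Suc 0) (\<lambda>e. P (e 0))"
    and step: "\<And>x. (\<And>y. y \<prec> x \<Longrightarrow> P y) \<Longrightarrow> P x"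
  shows "P x"
proof -
  have "\<forall>y. y \<prec> x \<longrightarrow> P y"
  proof (induct x rule: pa_induct)
    case 1 show ?case by (intro dfn_intros dfn_unary[of P, OF P]; simp)
  next
    case (3 x) then show ?case
      using step by (metis less_succ_iff N.le_less)
  qed simp
  then show ?thesis using step by blast
qed

section \<open>Coding definable bounded sets\<close>

definition divides_M where "divides_M a c \<longleftrightarrow> (\<exists>q. a \<otimes> q = c)"

lemma divides_mult: "divides_M a c \<Longrightarrow> divides_M a (c \<otimes> e)"
  unfolding divides_M_def by (metis mult_assoc)

lemma divides_add_cancel:
  assumes "divides_M a c" "divides_M a (c \<oplus> e)" shows "divides_M a e"
proof -
  obtain q r where "a \<otimes> q = c" "a \<otimes> r = c \<oplus> e" using assms by (auto simp: divides_M_def)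
  then have "a \<otimes> (r \<ominus> q) = e" by (simp add: mult_minus)
  then show ?thesis by (auto simp: divides_M_def)
qed

text \<open>A number of the form \<open>1 + x * m\<close> is coprime to \<open>m\<close>: if it divides \<open>e * m\<close>, it divides
  \<open>e * m * x + e\<close> and \<open>e * m * x\<close>, hence \<open>e\<close>. This replaces any theory of greatest common divisors.\<close>

lemma divides_cancel_coprime:
  assumes "divides_M (S (x \<otimes> m)) (e \<otimes> m)" shows "divides_M (S (x \<otimes> m)) e"
proof (rule divides_add_cancel)
  show "divides_M (S (x \<otimes> m)) (e \<otimes> m \<otimes> x)" using assms by (rule divides_mult)
  have "S (x \<otimes> m) \<otimes> e = e \<otimes> m \<otimes> x \<oplus> e"
    by (simp add: mult_comm mult_assoc N.mult.left_commute)
  then show "divides_M (S (x \<otimes> m)) (e \<otimes> m \<otimes> x \<oplus> e)" unfolding divides_M_def by blast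
qed

text \<open>The role of the factorial in Goedel's lemma, without defining factorials in the model.\<close>

lemma common_multiple: "\<exists>m. m \<noteq> \<zero> \<and> (\<forall>x. x \<prec> b \<longrightarrow> (\<exists>q. S x \<otimes> q = m))"
proof (induct b rule: pa_induct)
  case 1 show ?case by (intro dfn_intros; simp)
next
  case 2 show ?case by (intro exI[of _ "S \<zero>"]) simp
next
  case (3 b)
  then obtain m where m: "m \<noteq> \<zero>" "\<And>x. x \<prec> b \<Longrightarrow> \<exists>q. S x \<otimes> q = m" by blast
  have "\<exists>q. S x \<otimes> q = S b \<otimes> m" if "x \<prec> S b" for x
  proof (cases "x = b")
    case False
    then have "x \<prec> b" using that by (simp add: less_succ_iff N.le_less)
    then obtain q where "S x \<otimes> q = m" using m by blast
    then have "S x \<otimes> (S b \<otimes> q) = S b \<otimes> m" by (metis N.mult.left_commute)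
    then show ?thesis ..
  qed blast
  moreover have "S b \<otimes> m \<noteq> \<zero>" using m by (simp only: mult_eq_zero succ_neq_zero simp_thms)
  ultimately show ?case by blast
qed

text \<open>The two moduli differ by \<open>(j + 1) * m\<close> for some \<open>j\<close>, where \<open>j + 1\<close> divides \<open>m\<close>. Hence
  a modulus that divides \<open>d\<close> times the other one divides \<open>d * (j + 1) * m\<close>, and \<open>m\<close> and the factor
  \<open>j + 1\<close> can be removed by coprimality to \<open>m\<close>.\<close>

lemma coprime_factors:
  assumes m: "\<And>x. x \<prec> b \<Longrightarrow> \<exists>q. S x \<otimes> q = m"
    and "x \<prec> b" "k \<prec> b" "x \<noteq> k"
    and dv: "divides_M (S (S x \<otimes> m)) (d \<otimes> S (S k \<otimes> m))"
  shows "divides_M (S (S x \<otimes> m)) d"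
proof -
  let ?A = "S (S x \<otimes> m)"
  have dA: "divides_M ?A (d \<otimes> ?A)" unfolding divides_M_def by (metis mult_comm)
  have "\<exists>j. j \<prec> b \<and> divides_M ?A (d \<otimes> S j \<otimes> m)"
  proof (cases "x \<prec> k")
    case True
    then obtain j where k: "k = x \<oplus> S j" by (auto simp: less_M_def)
    have "S (S k \<otimes> m) = ?A \<oplus> S j \<otimes> m"
      by (simp add: k distrib_right add_assoc add_comm add_left_comm)
    then have "d \<otimes> S (S k \<otimes> m) = d \<otimes> ?A \<oplus> d \<otimes> S j \<otimes> m"
      by (simp only: distrib_left mult_assoc)
    then have "divides_M ?A (d \<otimes> S j \<otimes> m)" using divides_add_cancel dA dv by metis
    moreover have "j \<prec> b"
      using \<open>k \<prec> b\<close> unfolding k by (metis N.le_less_trans N.less_imp_le add_comm le_M_def succ_le_iff)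
    ultimately show ?thesis by blast
  next
    case False
    then have "k \<prec> x" using \<open>x \<noteq> k\<close> by (metis N.not_less N.le_less)
    then obtain j where x: "x = k \<oplus> S j" by (auto simp: less_M_def)
    have "?A = S (S k \<otimes> m) \<oplus> S j \<otimes> m"
      by (simp add: x distrib_right add_assoc add_comm add_left_comm)
    then have "d \<otimes> ?A = d \<otimes> S (S k \<otimes> m) \<oplus> d \<otimes> S j \<otimes> m"
      by (metis distrib_left mult_assoc)
    then have "divides_M ?A (d \<otimes> S j \<otimes> m)" using divides_add_cancel dA dv by metis
    moreover have "j \<prec> b"
      using \<open>x \<prec> b\<close> unfolding x by (metis N.le_less_trans N.less_imp_le add_comm le_M_def succ_le_iff)
    ultimately show ?thesis by blast
  qed
  then obtain j q where "divides_M ?A (d \<otimes> S j \<otimes> m)" "S j \<otimes> q = m" using m by blast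
  then have "divides_M ?A (d \<otimes> S j \<otimes> q)"
    using divides_cancel_coprime divides_mult by blast
  then have "divides_M ?A (d \<otimes> m)" using \<open>S j \<otimes> q = m\<close> by (simp only: mult_assoc)
  then show ?thesis by (rule divides_cancel_coprime)
qed

text \<open>The value of the formula \<open>mem\<close>.\<close>

definition code_set where
  "code_set b d m = {x. x \<prec> b \<and> (\<exists>q. S (S x \<otimes> m) \<otimes> q = d)}"

lemma pdef_divides: "pdef (\<lambda>e. divides_M (e i) (e j))"
  unfolding divides_M_def by (rule dfn_pdef[of i j i j], intro dfn_intros; simp)

lemmas dfn_divides [dfn_intros] = dfn_comp2[where P = divides_M, OF pdef_divides]

text \<open>Goedel's coding lemma. Let \<open>m\<close> be a common multiple of \<open>1, \<dots>, b\<close> and let \<open>d\<close> be the product of the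
  numbers \<open>1 + (x + 1) * m\<close> for the \<open>x\<close> to be coded. The product is built by internal induction,
  multiplying in one factor at a time.\<close>

lemma comprehension:
  assumes P: "dfn (Suc 0) (\<lambda>e. P (e 0))"
  obtains d m where "\<And>x. x \<in> code_set b d m \<longleftrightarrow> x \<prec> b \<and> P x"
proof -
  obtain m where m: "m \<noteq> \<zero>" "\<And>x. x \<prec> b \<Longrightarrow> \<exists>q. S x \<otimes> q = m"
    using common_multiple by blast
  have "k \<preceq> b \<longrightarrow> (\<exists>d. \<forall>x. x \<prec> b \<longrightarrow> (divides_M (S (S x \<otimes> m)) d \<longleftrightarrow> x \<prec> k \<and> P x))" for k
  proof (induct k rule: pa_induct)
    case 1 show ?case by (intro dfn_intros dfn_unary[of P, OF P]; simp)
  next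
    case 2
    \<comment> \<open>The empty product: as \<open>m \<noteq> 0\<close>, all the moduli exceed \<open>1\<close>.\<close>
    have "\<not> divides_M (S (S x \<otimes> m)) (S \<zero>)" for x
    proof
      assume "divides_M (S (S x \<otimes> m)) (S \<zero>)"
      then obtain q where q: "S (S x \<otimes> m) \<otimes> q = S \<zero>" by (auto simp: divides_M_def)
      obtain w r where "m = S w" "q = S r"
        using m(1) zero_or_succ[of m] zero_or_succ[of q] q by (metis mult_zero succ_neq_zero(1))
      then show False using q by simp
    qed
    then show ?case by auto
  next
    case (3 k)
    show ?case
    proof
      assume "S k \<preceq> b"
      then have k: "k \<prec> b" by (simp add: succ_le_iff)
      then obtain d where d: "\<And>x. x \<prec> b \<Longrightarrow> divides_M (S (S x \<otimes> m)) d \<longleftrightarrow> x \<prec> k \<and> P x"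
        using 3 by (auto simp: N.le_less)
      have less: "x \<prec> S k \<longleftrightarrow> x \<prec> k \<or> x = k" for x by (simp add: less_succ_iff N.le_less)
      show "\<exists>d. \<forall>x. x \<prec> b \<longrightarrow> (divides_M (S (S x \<otimes> m)) d \<longleftrightarrow> x \<prec> S k \<and> P x)"
      proof (cases "P k")
        case True
        have "divides_M (S (S x \<otimes> m)) (d \<otimes> S (S k \<otimes> m)) \<longleftrightarrow> x \<prec> S k \<and> P x" if x: "x \<prec> b" for x
        proof (cases "x = k")
          case True
          then show ?thesis using \<open>P k\<close> unfolding divides_M_def by (metis less_succ mult_comm)
        next
          case False
          then show ?thesis
            using coprime_factors[OF m(2) x k] divides_mult d[OF x] less by blast
        qed
        then show ?thesis by blast
      next
        case False
        then show ?thesis using d less by metis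
      qed
    qed
  qed
  then obtain d where "\<forall>x. x \<prec> b \<longrightarrow> (divides_M (S (S x \<otimes> m)) d \<longleftrightarrow> x \<prec> b \<and> P x)"
    by blast
  then show ?thesis using that[of d m] by (auto simp: code_set_def divides_M_def)
qed

section \<open>Inductively generated sets\<close>

text \<open>The value of the formula \<open>generated\<close>, where \<open>R\<close> is the value of the rules.\<close>

definition Gen :: "(('a \<Rightarrow> bool) \<Rightarrow> 'a \<Rightarrow> bool) \<Rightarrow> 'a \<Rightarrow> bool" where
  "Gen R x \<longleftrightarrow> (\<exists>b d m. x \<in> code_set b d m \<and>
     (\<forall>y. y \<in> code_set b d m \<longrightarrow> R (\<lambda>z. z \<in> code_set b d m) y))"

text \<open>A witness for \<open>x\<close> is also one for each of its elements.\<close>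

lemma Gen_rule:
  assumes mono: "\<And>X Y y. (\<And>z. X z \<Longrightarrow> Y z) \<Longrightarrow> R X y \<Longrightarrow> R Y y" and gen: "Gen R x"
  shows "R (Gen R) x"
proof -
  obtain b d m where x: "x \<in> code_set b d m"
    and *: "\<forall>y. y \<in> code_set b d m \<longrightarrow> R (\<lambda>z. z \<in> code_set b d m) y"
    using gen by (auto simp: Gen_def)
  have "Gen R z" if "z \<in> code_set b d m" for z
    unfolding Gen_def by (intro exI conjI, rule that, rule *)
  then show ?thesis by (rule mono[OF _ *[rule_format, OF x]])
qed

text \<open>For the direction from right to left, a coded set that contains \<open>y\<close> and is closed
  under taking premises is needed. All generated elements below \<open>y\<close>, together with \<open>y\<close>,
  form such a set, because \<open>below\<close> provides premises that are smaller than the conclusion; it has a code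
  since it is bounded and definable.\<close>

lemma Gen_unfold_below:
  assumes P: "dfn (Suc 0) (\<lambda>e. Gen R (e 0))"
    and mono: "\<And>X Y y. (\<And>z. X z \<Longrightarrow> Y z) \<Longrightarrow> R X y \<Longrightarrow> R Y y"
    and below: "\<And>y. R (Gen R) y \<Longrightarrow> R (\<lambda>z. z \<prec> y \<and> Gen R z) y"
  shows "Gen R y \<longleftrightarrow> R (Gen R) y"
proof
  have rule: "Gen R x \<Longrightarrow> R (Gen R) x" for x by (rule Gen_rule[OF mono])
  then show "Gen R y \<Longrightarrow> R (Gen R) y" .
  assume y: "R (Gen R) y"
  have "dfn (Suc 0) (\<lambda>e. Gen R (e 0) \<or> e 0 = y)"
    by (intro dfn_or P dfn_eq dfn_fun_var dfn_fun_param) simp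
  then obtain d m where s: "\<And>x. x \<in> code_set (S y) d m \<longleftrightarrow> x \<prec> S y \<and> (Gen R x \<or> x = y)"
    by (rule comprehension[where b = "S y"]) (rule that, assumption)
  have closed: "R (\<lambda>z. z \<in> code_set (S y) d m) x" if x: "x \<in> code_set (S y) d m" for x
  proof (rule mono)
    have "R (Gen R) x" using x rule[of x] y unfolding s by blast
    then show "R (\<lambda>z. z \<prec> x \<and> Gen R z) x" by (rule below)
    show "z \<in> code_set (S y) d m" if "z \<prec> x \<and> Gen R z" for z
      using that x N.less_trans[of z x "S y"] unfolding s by simp
  qed
  have "y \<in> code_set (S y) d m" by (simp add: s)
  then show "Gen R y" unfolding Gen_def
    by (intro exI conjI allI impI) (assumption, rule closed)
qed

text \<open>The case of rules all of whose premises are smaller than their conclusion.\<close>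

lemma Gen_unfold:
  assumes "dfn (Suc 0) (\<lambda>e. Gen R (e 0))"
    and mono: "\<And>X Y y. (\<And>z. z \<prec> y \<Longrightarrow> X z \<Longrightarrow> Y z) \<Longrightarrow> R X y \<Longrightarrow> R Y y"
  shows "Gen R y \<longleftrightarrow> R (Gen R) y"
proof (rule Gen_unfold_below[OF assms(1)])
  show "R Y y" if "\<And>z. X z \<Longrightarrow> Y z" "R X y" for X Y y
    by (rule mono[OF _ that(2)]) (rule that(1))
  show "R (\<lambda>z. z \<prec> y \<and> Gen R z) y" if "R (Gen R) y" for y
    by (rule mono[OF _ that]) simp
qed

section \<open>Codes\<close>

definition pair_M where "pair_M x y = (x \<oplus> y) \<otimes> (x \<oplus> y) \<oplus> x"

fun tag :: "nat \<Rightarrow> 'a" where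
  "tag 0 = \<zero>"
| "tag (Suc k) = S (tag k)"

declare tag.simps [simp del]

lemma tag_inject [simp]: "tag i = tag j \<longleftrightarrow> i = j"
proof (induction i arbitrary: j)
  case 0 then show ?case by (cases j) (simp_all add: tag.simps)
next
  case (Suc i) then show ?case by (cases j) (simp_all add: tag.simps)
qed

lemma square_ge: "z \<preceq> z \<otimes> z"
proof -
  have "z = \<zero> \<or> (\<exists>w. z = S w)" by (rule zero_or_succ)
  then show ?thesis
  proof
    assume "\<exists>w. z = S w"
    then obtain w where "z = S w" ..
    then have "z \<otimes> z = z \<oplus> z \<otimes> w" by (metis mult_succ add_comm)
    then show ?thesis by (auto simp: le_iff_add)
  qed (simp add: zero_le)
qed

lemma le_add_left: "x \<preceq> y \<oplus> x" and le_add_right: "x \<preceq> x \<oplus> y"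
  using add_comm by (auto simp: le_iff_add)

lemma pair_ge: "x \<preceq> pair_M x y" "y \<preceq> pair_M x y"
proof -
  show "x \<preceq> pair_M x y" unfolding pair_M_def by (rule le_add_left)
  have "y \<preceq> x \<oplus> y" by (rule le_add_left)
  also have "x \<oplus> y \<preceq> (x \<oplus> y) \<otimes> (x \<oplus> y)" by (rule square_ge)
  also have "\<dots> \<preceq> pair_M x y" unfolding pair_M_def by (rule le_add_right)
  finally show "y \<preceq> pair_M x y" .
qed

lemma mult_mono_M: "a \<preceq> b \<Longrightarrow> c \<preceq> d \<Longrightarrow> a \<otimes> c \<preceq> b \<otimes> d"
  by (rule N.mult_mono) (simp_all add: zero_le)

lemma pair_less: "a \<prec> a' \<Longrightarrow> b \<preceq> b' \<Longrightarrow> pair_M a b \<prec> pair_M a' b'"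
  unfolding pair_M_def
  by (intro N.add_le_less_mono mult_mono_M N.add_mono) (simp_all add: N.less_imp_le)

text \<open>The pair lies between the squares of \<open>x + y\<close> and of \<open>x + y + 1\<close>, so it determines the sum
  \<open>x + y\<close> and then \<open>x\<close>.\<close>

lemma pair_inject [simp]: "pair_M x y = pair_M u v \<longleftrightarrow> x = u \<and> y = v"
proof -
  have less: "pair_M x y \<prec> pair_M u v" if "x \<oplus> y \<prec> u \<oplus> v" for x y u v
  proof -
    let ?s = "x \<oplus> y"
    have "pair_M x y \<preceq> ?s \<otimes> ?s \<oplus> ?s"
      unfolding pair_M_def by (intro add_mono_left le_add_right)
    also have "\<dots> \<prec> S ?s \<otimes> S ?s" unfolding succ_mult mult_succ less_M_def by (auto simp: add_assoc)
    also have "\<dots> \<preceq> (u \<oplus> v) \<otimes> (u \<oplus> v)" using that by (intro mult_mono_M) (simp_all only: succ_le_iff)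
    also have "\<dots> \<preceq> pair_M u v" unfolding pair_M_def by (rule le_add_right)
    finally show ?thesis .
  qed
  show ?thesis
  proof
    assume eq: "pair_M x y = pair_M u v"
    then have s: "x \<oplus> y = u \<oplus> v" using less[of x y u v] less[of u v x y] by (metis N.less_irrefl N.linorder_cases)
    then have "x = u" using eq unfolding pair_M_def by (metis add_left_cancel)
    then show "x = u \<and> y = v" using s by simp
  qed simp
qed

text \<open>All codes of syntax are of one of two shapes, with the tag telling which constructor they stand
  for. From here on only injectivity, distinctness and size of these codes are used.\<close>

definition code1 :: "nat \<Rightarrow> 'a \<Rightarrow> 'a" where "code1 c x = pair_M (tag c) x"
definition code2 :: "nat \<Rightarrow> 'a \<Rightarrow> 'a \<Rightarrow> 'a" where "code2 c x y = code1 c (pair_M x y)"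

lemma code_inject [simp]:
  "code1 c x = code1 d y \<longleftrightarrow> c = d \<and> x = y"
  "code2 c x y = code2 d u v \<longleftrightarrow> c = d \<and> x = u \<and> y = v"
  by (simp_all add: code1_def code2_def)

lemma code_distinct [simp]: "c \<noteq> d \<Longrightarrow> code1 c x \<noteq> code2 d u v" "c \<noteq> d \<Longrightarrow> code2 d u v \<noteq> code1 c x"
  by (simp_all add: code2_def)

lemma code1_less [simp]: "c \<noteq> 0 \<Longrightarrow> x \<prec> code1 c x"
proof -
  assume "c \<noteq> 0"
  then obtain k where c: "tag c = S (tag k)" by (cases c) (auto simp: tag.simps)
  let ?s = "S (tag k) \<oplus> x"
  have "x \<preceq> ?s" by (rule le_add_left)
  also have "?s \<preceq> ?s \<otimes> ?s" by (rule square_ge)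
  also have "\<dots> \<prec> ?s \<otimes> ?s \<oplus> S (tag k)" unfolding less_M_def by blast
  finally show ?thesis by (simp only: code1_def pair_M_def c)
qed

lemma code2_less [simp]: assumes "c \<noteq> 0" shows "x \<prec> code2 c x y" "y \<prec> code2 c x y"
  unfolding code2_def using pair_ge[of x y] pair_ge[of y x] code1_less[OF assms, of "pair_M x y"]
  by (auto intro: N.le_less_trans pair_ge)

lemma dfn_fun_pair [dfn_intros]:
  "dfn_fun n f \<Longrightarrow> dfn_fun n g \<Longrightarrow> dfn_fun n (\<lambda>e. pair_M (f e) (g e))"
  unfolding pair_M_def by (intro dfn_intros)

lemma dfn_fun_code [dfn_intros]:
  "dfn_fun n f \<Longrightarrow> dfn_fun n (\<lambda>e. code1 c (f e))"
  "dfn_fun n f \<Longrightarrow> dfn_fun n g \<Longrightarrow> dfn_fun n (\<lambda>e. code2 c (f e) (g e))"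
  unfolding code1_def code2_def by (intro dfn_intros; assumption)+

section \<open>Arithmetized syntax in the model\<close>

text \<open>The following predicates on the model are the values of the formulae of arithmetized syntax.
  The rules for graphs are named separately, since the generated sets consist of pairs.\<close>

definition "Vr v \<longleftrightarrow> (\<exists>i. v = code1 0 i)"

definition Trm :: "'a \<Rightarrow> bool" where
  "Trm = Gen (\<lambda>X y.
     Vr y \<or>
     y = code1 1 \<zero> \<or>
     (\<exists>s. X s \<and> y = code1 2 s) \<or>
     (\<exists>s t. X s \<and> X t \<and> (y = code2 3 s t \<or> y = code2 4 s t)))"

definition Frm :: "'a \<Rightarrow> bool" where
  "Frm = Gen (\<lambda>X y.
     (\<exists>s t. Trm s \<and> Trm t \<and> y = code2 5 s t) \<or>
     (\<exists>p. X p \<and> y = code1 6 p) \<or>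
     (\<exists>p q. X p \<and> X q \<and> y = code2 7 p q) \<or>
     (\<exists>v p. Vr v \<and> X p \<and> y = code2 8 v p))"

definition Occ :: "'a \<Rightarrow> 'a \<Rightarrow> bool" where
  "Occ v = Gen (\<lambda>X y.
     y = v \<or>
     (\<exists>s. X s \<and> (y = code1 2 s \<or> y = code1 6 s)) \<or>
     (\<exists>s t. (X s \<or> X t) \<and>
        (y = code2 3 s t \<or> y = code2 4 s t \<or> y = code2 5 s t \<or> y = code2 7 s t)) \<or>
     (\<exists>u p. u \<noteq> v \<and> X p \<and> y = code2 8 u p))"

definition Num_rule :: "('a \<Rightarrow> bool) \<Rightarrow> 'a \<Rightarrow> bool" where
  "Num_rule X y \<longleftrightarrow>
     y = pair_M \<zero> (code1 1 \<zero>) \<or>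
     (\<exists>a k. X (pair_M a k) \<and> y = pair_M (S a) (code1 2 k))"

definition Val_rule :: "('a \<Rightarrow> bool) \<Rightarrow> 'a \<Rightarrow> bool" where
  "Val_rule X y \<longleftrightarrow>
     y = pair_M (code1 1 \<zero>) \<zero> \<or>
     (\<exists>s a. X (pair_M s a) \<and> y = pair_M (code1 2 s) (S a)) \<or>
     (\<exists>s t a b. X (pair_M s a) \<and> X (pair_M t b) \<and>
        (y = pair_M (code2 3 s t) (a \<oplus> b) \<or> y = pair_M (code2 4 s t) (a \<otimes> b)))"

definition Sub_rule :: "'a \<Rightarrow> 'a \<Rightarrow> ('a \<Rightarrow> bool) \<Rightarrow> 'a \<Rightarrow> bool" where
  "Sub_rule v r X y \<longleftrightarrow>
     y = pair_M v r \<or>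
     (\<exists>u. Vr u \<and> u \<noteq> v \<and> y = pair_M u u) \<or>
     y = pair_M (code1 1 \<zero>) (code1 1 \<zero>) \<or>
     (\<exists>s s'. X (pair_M s s') \<and>
        (y = pair_M (code1 2 s) (code1 2 s') \<or> y = pair_M (code1 6 s) (code1 6 s'))) \<or>
     (\<exists>s s' t t'. X (pair_M s s') \<and> X (pair_M t t') \<and>
        (y = pair_M (code2 3 s t) (code2 3 s' t') \<or> y = pair_M (code2 4 s t) (code2 4 s' t') \<or>
         y = pair_M (code2 5 s t) (code2 5 s' t') \<or> y = pair_M (code2 7 s t) (code2 7 s' t'))) \<or>
     (\<exists>p. y = pair_M (code2 8 v p) (code2 8 v p)) \<or>
     (\<exists>u p p'. u \<noteq> v \<and> X (pair_M p p') \<and> y = pair_M (code2 8 u p) (code2 8 u p'))"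

definition Num :: "'a \<Rightarrow> 'a \<Rightarrow> bool" where "Num x n \<longleftrightarrow> Gen Num_rule (pair_M x n)"
definition Val :: "'a \<Rightarrow> 'a \<Rightarrow> bool" where "Val s a \<longleftrightarrow> Gen Val_rule (pair_M s a)"
definition Sub :: "'a \<Rightarrow> 'a \<Rightarrow> 'a \<Rightarrow> 'a \<Rightarrow> bool" where
  "Sub v r x x' \<longleftrightarrow> Gen (Sub_rule v r) (pair_M x x')"

definition "ClosedTrm s \<longleftrightarrow> Trm s \<and> (\<forall>v. Vr v \<longrightarrow> \<not> Occ v s)"
definition "Sent p \<longleftrightarrow> Frm p \<and> (\<forall>v. Vr v \<longrightarrow> \<not> Occ v p)"
definition "Frm_in v p \<longleftrightarrow> Vr v \<and> Frm p \<and> (\<forall>u. Vr u \<and> Occ u p \<longrightarrow> u = v)"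

text \<open>The evaluation of a formula written with automatically chosen variables. The side conditions
  \<open>tbelow n t\<close> below state that the variable bound at \<open>n\<close> does not occur in the ambient term \<open>t\<close>.\<close>

lemma sat_builders [simp]:
  "sat M T e ((s \<^bold>= t) n) \<longleftrightarrow> val M e s = val M e t"
  "sat M T e (\<^bold>T t n) \<longleftrightarrow> val M e t \<in> T"
  "sat M T e ((\<^bold>\<not> F) n) \<longleftrightarrow> \<not> sat M T e (F n)"
  "sat M T e ((F \<^bold>\<or> G) n) \<longleftrightarrow> sat M T e (F n) \<or> sat M T e (G n)"
  "sat M T e ((F \<^bold>\<and> G) n) \<longleftrightarrow> sat M T e (F n) \<and> sat M T e (G n)"
  "sat M T e ((F \<^bold>\<longrightarrow> G) n) \<longleftrightarrow> (sat M T e (F n) \<longrightarrow> sat M T e (G n))"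
  "sat M T e ((F \<^bold>\<longleftrightarrow> G) n) \<longleftrightarrow> (sat M T e (F n) \<longleftrightarrow> sat M T e (G n))"
  "sat M T e (bEx H n) \<longleftrightarrow> (\<exists>a. sat M T (e(n := a)) (H (Var n) (Suc n)))"
  "sat M T e (bAll H n) \<longleftrightarrow> (\<forall>a. sat M T (e(n := a)) (H (Var n) (Suc n)))"
  by (auto simp: bEq_def bTr_def bNeg_def bOr_def bAnd_def bImp_def bIff_def bEx_def bAll_def)

lemma arithmetical_builders [simp]:
  "arithmetical ((s \<^bold>= t) n)"
  "arithmetical ((\<^bold>\<not> F) n) \<longleftrightarrow> arithmetical (F n)"
  "arithmetical ((F \<^bold>\<or> G) n) \<longleftrightarrow> arithmetical (F n) \<and> arithmetical (G n)"
  "arithmetical ((F \<^bold>\<and> G) n) \<longleftrightarrow> arithmetical (F n) \<and> arithmetical (G n)"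
  "arithmetical ((F \<^bold>\<longrightarrow> G) n) \<longleftrightarrow> arithmetical (F n) \<and> arithmetical (G n)"
  "arithmetical (bEx H n) \<longleftrightarrow> arithmetical (H (Var n) (Suc n))"
  "arithmetical (bAll H n) \<longleftrightarrow> arithmetical (H (Var n) (Suc n))"
  by (auto simp: bEq_def bTr_def bNeg_def bOr_def bAnd_def bImp_def bIff_def bEx_def bAll_def)

lemma tbelow_codes [simp]:
  "tbelow n (pr s t) \<longleftrightarrow> tbelow n s \<and> tbelow n t"
  "tbelow n (cVar s) \<longleftrightarrow> tbelow n s" "tbelow n cZero" "tbelow n (cSucc s) \<longleftrightarrow> tbelow n s"
  "tbelow n (cNeg s) \<longleftrightarrow> tbelow n s"
  "tbelow n (cAdd s t) \<longleftrightarrow> tbelow n s \<and> tbelow n t" "tbelow n (cMult s t) \<longleftrightarrow> tbelow n s \<and> tbelow n t"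
  "tbelow n (cEq s t) \<longleftrightarrow> tbelow n s \<and> tbelow n t" "tbelow n (cOr s t) \<longleftrightarrow> tbelow n s \<and> tbelow n t"
  "tbelow n (cEx s t) \<longleftrightarrow> tbelow n s \<and> tbelow n t"
  by (auto simp: pr_def cVar_def cZero_def cSucc_def cNeg_def cAdd_def cMult_def cEq_def cOr_def cEx_def)

lemma val_num [simp]: "val M e (num k) = tag k"
  by (induction k) (simp_all add: tag.simps)

lemma val_codes [simp]:
  "val M e (pr s t) = pair_M (val M e s) (val M e t)"
  "val M e (cVar s) = code1 0 (val M e s)"
  "val M e cZero = code1 1 \<zero>"
  "val M e (cSucc s) = code1 2 (val M e s)"
  "val M e (cNeg s) = code1 6 (val M e s)"
  "val M e (cAdd s t) = code2 3 (val M e s) (val M e t)"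
  "val M e (cMult s t) = code2 4 (val M e s) (val M e t)"
  "val M e (cEq s t) = code2 5 (val M e s) (val M e t)"
  "val M e (cOr s t) = code2 7 (val M e s) (val M e t)"
  "val M e (cEx s t) = code2 8 (val M e s) (val M e t)"
  by (simp_all add: pr_def cVar_def cZero_def cSucc_def cNeg_def cAdd_def cMult_def cEq_def
      cOr_def cEx_def code1_def code2_def pair_M_def del: num.simps)

lemma sat_mem [simp]:
  "tbelow n x \<Longrightarrow> tbelow n b \<Longrightarrow> tbelow n d \<Longrightarrow> tbelow n m \<Longrightarrow>
   sat M T e (mem x b d m n) \<longleftrightarrow> val M e x \<in> code_set (val M e b) (val M e d) (val M e m)"
  by (simp add: mem_def code_set_def less_M_def del: add_succ succ_mult)

lemma sat_is_var [simp]: "tbelow n v \<Longrightarrow> sat M T e (is_var v n) \<longleftrightarrow> Vr (val M e v)"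
  by (simp add: is_var_def Vr_def)

lemma sat_is_term [simp]: "tbelow n x \<Longrightarrow> sat M T e (is_term x n) \<longleftrightarrow> Trm (val M e x)"
  by (simp add: is_term_def generated_def Trm_def Gen_def)

lemma sat_is_form [simp]: "tbelow n x \<Longrightarrow> sat M T e (is_form x n) \<longleftrightarrow> Frm (val M e x)"
  by (simp add: is_form_def generated_def Frm_def Gen_def)

lemma sat_occurs_free [simp]:
  "tbelow n v \<Longrightarrow> tbelow n x \<Longrightarrow> sat M T e (occurs_free v x n) \<longleftrightarrow> Occ (val M e v) (val M e x)"
  by (simp add: occurs_free_def generated_def Occ_def Gen_def)

lemma sat_is_numeral [simp]:
  "tbelow n v \<Longrightarrow> tbelow n x \<Longrightarrow> sat M T e (is_numeral v x n) \<longleftrightarrow> Num (val M e v) (val M e x)"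
  by (simp add: is_numeral_def generated_def Num_def Num_rule_def Gen_def)

lemma sat_is_value [simp]:
  "tbelow n v \<Longrightarrow> tbelow n x \<Longrightarrow> sat M T e (is_value v x n) \<longleftrightarrow> Val (val M e v) (val M e x)"
  by (simp add: is_value_def generated_def Val_def Val_rule_def Gen_def)

lemma sat_is_subst [simp]:
  "tbelow n v \<Longrightarrow> tbelow n r \<Longrightarrow> tbelow n x \<Longrightarrow> tbelow n x' \<Longrightarrow>
    sat M T e (is_subst v r x x' n) \<longleftrightarrow> Sub (val M e v) (val M e r) (val M e x) (val M e x')"
  by (simp add: is_subst_def generated_def Sub_def Sub_rule_def Gen_def)

lemma sat_is_closed_term [simp]:
  "tbelow n x \<Longrightarrow> sat M T e (is_closed_term x n) \<longleftrightarrow> ClosedTrm (val M e x)"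
  by (simp add: is_closed_term_def ClosedTrm_def)

lemma sat_is_sentence [simp]:
  "tbelow n x \<Longrightarrow> sat M T e (is_sentence x n) \<longleftrightarrow> Sent (val M e x)"
  by (simp add: is_sentence_def Sent_def)

lemma sat_is_form_in [simp]:
  "tbelow n v \<Longrightarrow> tbelow n x \<Longrightarrow> sat M T e (is_form_in v x n) \<longleftrightarrow> Frm_in (val M e v) (val M e x)"
  by (simp add: is_form_in_def Frm_in_def)

lemma sat_is_form1 [simp]:
  "tbelow n x \<Longrightarrow> sat M T e (is_form1 x n) \<longleftrightarrow> (\<exists>v. Frm_in v (val M e x))"
  by (simp add: is_form1_def)

lemmas syntax_defs = generated_def mem_def is_var_def is_term_def is_form_def occurs_free_def
  is_numeral_def is_value_def is_subst_def

lemma pdef_syntax: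
  "pdef (\<lambda>e. Trm (e i))" "pdef (\<lambda>e. Frm (e i))" "pdef (\<lambda>e. Occ (e i) (e j))"
  "pdef (\<lambda>e. Num (e i) (e j))" "pdef (\<lambda>e. Val (e i) (e j))" "pdef (\<lambda>e. Sub (e i) (e j) (e k) (e l))"
  subgoal
    by (rule pdef_formula[of "is_term (Var (2*i)) (Suc (2*i))"]) (simp_all, simp add: syntax_defs)
  subgoal
    by (rule pdef_formula[of "is_form (Var (2*i)) (Suc (2*i))"]) (simp_all, simp add: syntax_defs)
  subgoal
    by (rule pdef_formula[of "occurs_free (Var (2*i)) (Var (2*j)) (Suc (2*i+2*j))"]) (simp_all, simp add: syntax_defs)
  subgoal
    by (rule pdef_formula[of "is_numeral (Var (2*i)) (Var (2*j)) (Suc (2*i+2*j))"]) (simp_all, simp add: syntax_defs)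
  subgoal
    by (rule pdef_formula[of "is_value (Var (2*i)) (Var (2*j)) (Suc (2*i+2*j))"]) (simp_all, simp add: syntax_defs)
  subgoal
    by (rule pdef_formula[of "is_subst (Var (2*i)) (Var (2*j)) (Var (2*k)) (Var (2*l)) (Suc (2*i+2*j+2*k+2*l))"])
      (simp_all, simp add: syntax_defs)
  done

lemmas dfn_syntax [dfn_intros] =
  dfn_comp1[where P = Trm, OF pdef_syntax(1)] dfn_comp1[where P = Frm, OF pdef_syntax(2)]
  dfn_comp2[where P = Occ, OF pdef_syntax(3)] dfn_comp2[where P = Num, OF pdef_syntax(4)]
  dfn_comp2[where P = Val, OF pdef_syntax(5)] dfn_comp4[where P = Sub, OF pdef_syntax(6)]

lemma pdef_Vr: "pdef (\<lambda>e. Vr (e i))"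
  unfolding Vr_def by (rule dfn_pdef[of i i i i], intro dfn_intros; simp)

lemmas dfn_Vr [dfn_intros] = dfn_comp1[where P = Vr, OF pdef_Vr]

section \<open>Recursion equations for the syntactic predicates\<close>

lemma Vr_code [simp]: "Vr (code1 c i) \<longleftrightarrow> c = 0" "c \<noteq> 0 \<Longrightarrow> \<not> Vr (code2 c x y)"
  by (auto simp: Vr_def)

lemma Trm_unfold:
  "Trm y \<longleftrightarrow> Vr y \<or> y = code1 1 \<zero> \<or> (\<exists>s. Trm s \<and> y = code1 2 s) \<or>
     (\<exists>s t. Trm s \<and> Trm t \<and> (y = code2 3 s t \<or> y = code2 4 s t))"
  unfolding Trm_def
proof (rule Gen_unfold, fold Trm_def)
  show "dfn (Suc 0) (\<lambda>e. Trm (e 0))" by (intro dfn_intros; simp)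
qed auto

lemma Frm_unfold:
  "Frm y \<longleftrightarrow> (\<exists>s t. Trm s \<and> Trm t \<and> y = code2 5 s t) \<or>
     (\<exists>p. Frm p \<and> y = code1 6 p) \<or>
     (\<exists>p q. Frm p \<and> Frm q \<and> y = code2 7 p q) \<or>
     (\<exists>v p. Vr v \<and> Frm p \<and> y = code2 8 v p)"
  unfolding Frm_def
proof (rule Gen_unfold, fold Frm_def)
  show "dfn (Suc 0) (\<lambda>e. Frm (e 0))" by (intro dfn_intros; simp)
qed auto

lemma Occ_unfold:
  "Occ v y \<longleftrightarrow> y = v \<or>
     (\<exists>s. Occ v s \<and> (y = code1 2 s \<or> y = code1 6 s)) \<or>
     (\<exists>s t. (Occ v s \<or> Occ v t) \<and>
        (y = code2 3 s t \<or> y = code2 4 s t \<or> y = code2 5 s t \<or> y = code2 7 s t)) \<or>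
     (\<exists>u p. u \<noteq> v \<and> Occ v p \<and> y = code2 8 u p)"
  unfolding Occ_def
proof (rule Gen_unfold, fold Occ_def)
  show "dfn (Suc 0) (\<lambda>e. Occ v (e 0))" by (intro dfn_intros; simp)
qed auto

lemma Trm_code [simp]:
  "Vr v \<Longrightarrow> Trm v" "Trm (code1 (Suc 0) \<zero>)" "Trm (code1 2 s) \<longleftrightarrow> Trm s"
  "Trm (code2 3 s t) \<longleftrightarrow> Trm s \<and> Trm t" "Trm (code2 4 s t) \<longleftrightarrow> Trm s \<and> Trm t"
  "\<not> Trm (code2 5 s t)" "\<not> Trm (code1 6 s)" "\<not> Trm (code2 7 s t)" "\<not> Trm (code2 8 s t)"
  by (subst Trm_unfold; auto)+

lemma Frm_code [simp]:
  "Frm (code2 5 s t) \<longleftrightarrow> Trm s \<and> Trm t" "Frm (code1 6 p) \<longleftrightarrow> Frm p"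
  "Frm (code2 7 p q) \<longleftrightarrow> Frm p \<and> Frm q" "Frm (code2 8 v p) \<longleftrightarrow> Vr v \<and> Frm p"
  by (subst Frm_unfold; auto)+

text \<open>Substitution and free occurrence treat the constructors of terms and those of formulae alike;
  grouping them by arity leaves a single case for each arity.\<close>

definition un_tag :: "nat \<Rightarrow> bool" where "un_tag c \<longleftrightarrow> c = 2 \<or> c = 6"
definition bin_tag :: "nat \<Rightarrow> bool" where "bin_tag c \<longleftrightarrow> c = 3 \<or> c = 4 \<or> c = 5 \<or> c = 7"

lemma tag_simps [simp]: "un_tag 2" "un_tag 6" "bin_tag 3" "bin_tag 4" "bin_tag 5" "bin_tag 7"
  by (simp_all add: un_tag_def bin_tag_def)

lemma Occ_code [simp]:
  assumes "Vr v"
  shows "Vr u \<Longrightarrow> Occ v u \<longleftrightarrow> u = v" "\<not> Occ v (code1 (Suc 0) \<zero>)"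
    "un_tag c \<Longrightarrow> Occ v (code1 c s) \<longleftrightarrow> Occ v s"
    "bin_tag c \<Longrightarrow> Occ v (code2 c s t) \<longleftrightarrow> Occ v s \<or> Occ v t"
    "Occ v (code2 8 u p) \<longleftrightarrow> u \<noteq> v \<and> Occ v p"
proof -
  obtain i where v: "v = code1 0 i" using assms by (auto simp: Vr_def)
  show "Vr u \<Longrightarrow> Occ v u \<longleftrightarrow> u = v" unfolding Occ_unfold[of v u] Vr_def by auto
  show "\<not> Occ v (code1 (Suc 0) \<zero>)" unfolding Occ_unfold[of v "code1 (Suc 0) \<zero>"] unfolding v by simp
  show "un_tag c \<Longrightarrow> Occ v (code1 c s) \<longleftrightarrow> Occ v s"
    unfolding Occ_unfold[of v "code1 c s"] unfolding v un_tag_def by (elim disjE) simp_all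
  show "bin_tag c \<Longrightarrow> Occ v (code2 c s t) \<longleftrightarrow> Occ v s \<or> Occ v t"
    unfolding Occ_unfold[of v "code2 c s t"] unfolding v bin_tag_def by (elim disjE) simp_all
  show "Occ v (code2 8 u p) \<longleftrightarrow> u \<noteq> v \<and> Occ v p"
    unfolding Occ_unfold[of v "code2 8 u p"] unfolding v by simp
qed

lemma Trm_induct [consumes 1, case_names definable var zero succ bin]:
  assumes x: "Trm x" and P: "dfn (Suc 0) (\<lambda>e. P (e 0))"
    and "\<And>v. Vr v \<Longrightarrow> P v" "P (code1 1 \<zero>)" "\<And>s. Trm s \<Longrightarrow> P s \<Longrightarrow> P (code1 2 s)"
    and "\<And>c s t. c = 3 \<or> c = 4 \<Longrightarrow> Trm s \<Longrightarrow> Trm t \<Longrightarrow> P s \<Longrightarrow> P t \<Longrightarrow> P (code2 c s t)"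
  shows "P x"
proof -
  have "Trm x \<longrightarrow> P x"
  proof (induct x rule: less_induct_M)
    case 1 show ?case by (intro dfn_intros dfn_unary[of P, OF P]; simp)
  next
    case (2 x)
    show ?case
    proof
      assume "Trm x"
      have IH: "P y" if "y \<prec> x" "Trm y" for y
        using 2[OF that(1)] that(2) by simp
      from \<open>Trm x\<close> consider "Vr x" | "x = code1 1 \<zero>" | s where "Trm s" "x = code1 2 s"
        | s t where "Trm s" "Trm t" "x = code2 3 s t" | s t where "Trm s" "Trm t" "x = code2 4 s t"
        using Trm_unfold[of x] by blast
      then show "P x"
      proof cases
        case 1 then show ?thesis by (rule assms(3))
      next
        case 2 show ?thesis unfolding 2 by (rule assms(4))
      next
        case (3 s) show ?thesis unfolding 3(2) by (rule assms(5)[OF 3(1) IH]) (simp_all add: 3)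
      next
        case (4 s t)
        show ?thesis unfolding 4(3) by (rule assms(6)[OF _ 4(1,2) IH IH]) (simp_all add: 4)
      next
        case (5 s t)
        show ?thesis unfolding 5(3) by (rule assms(6)[OF _ 5(1,2) IH IH]) (simp_all add: 5)
      qed
    qed
  qed
  then show ?thesis using x by blast
qed

lemma Frm_induct [consumes 1, case_names definable eq neg or ex]:
  assumes x: "Frm x" and P: "dfn (Suc 0) (\<lambda>e. P (e 0))"
    and "\<And>s t. Trm s \<Longrightarrow> Trm t \<Longrightarrow> P (code2 5 s t)"
    and "\<And>p. Frm p \<Longrightarrow> P p \<Longrightarrow> P (code1 6 p)"
    and "\<And>p q. Frm p \<Longrightarrow> Frm q \<Longrightarrow> P p \<Longrightarrow> P q \<Longrightarrow> P (code2 7 p q)"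
    and "\<And>v p. Vr v \<Longrightarrow> Frm p \<Longrightarrow> P p \<Longrightarrow> P (code2 8 v p)"
  shows "P x"
proof -
  have "Frm x \<longrightarrow> P x"
  proof (induct x rule: less_induct_M)
    case 1 show ?case by (intro dfn_intros dfn_unary[of P, OF P]; simp)
  next
    case (2 x)
    show ?case
    proof
      assume "Frm x"
      have IH: "P y" if "y \<prec> x" "Frm y" for y
        using 2[OF that(1)] that(2) by simp
      from \<open>Frm x\<close> consider s t where "Trm s" "Trm t" "x = code2 5 s t" | p where "Frm p" "x = code1 6 p"
        | p q where "Frm p" "Frm q" "x = code2 7 p q" | v p where "Vr v" "Frm p" "x = code2 8 v p"
        using Frm_unfold[of x] by blast
      then show "P x"
      proof cases
        case (1 s t) show ?thesis unfolding 1(3) by (rule assms(3)[OF 1(1,2)])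
      next
        case (2 p) show ?thesis unfolding 2(2) by (rule assms(4)[OF 2(1) IH]) (simp_all add: 2)
      next
        case (3 p q)
        show ?thesis unfolding 3(3) by (rule assms(5)[OF 3(1,2) IH IH]) (simp_all add: 3)
      next
        case (4 v p) show ?thesis unfolding 4(3) by (rule assms(6)[OF 4(1,2) IH]) (simp_all add: 4)
      qed
    qed
  qed
  then show ?thesis using x by blast
qed

definition "Expr x \<longleftrightarrow> Trm x \<or> Frm x"

lemma Expr_induct [consumes 1, case_names definable var zero un bin ex]:
  assumes x: "Expr x" and P: "dfn (Suc 0) (\<lambda>e. P (e 0))"
    and var: "\<And>v. Vr v \<Longrightarrow> P v" and zero: "P (code1 1 \<zero>)"
    and un: "\<And>c s. un_tag c \<Longrightarrow> Expr s \<Longrightarrow> P s \<Longrightarrow> P (code1 c s)"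
    and bin: "\<And>c s t. bin_tag c \<Longrightarrow> Expr s \<Longrightarrow> Expr t \<Longrightarrow> P s \<Longrightarrow> P t \<Longrightarrow> P (code2 c s t)"
    and ex: "\<And>v p. Vr v \<Longrightarrow> Expr p \<Longrightarrow> P p \<Longrightarrow> P (code2 8 v p)"
  shows "P x"
proof -
  have T: "P x" if "Trm x" for x
    using that
  proof (induct rule: Trm_induct)
    case definable show ?case by (rule P)
  next
    case (var v) then show ?case by (rule assms(3))
  next
    case zero show ?case by (rule assms(4))
  next
    case (succ s) then show ?case using un[of 2 s] by (simp add: Expr_def)
  next
    case (bin c s t) then show ?case using assms(6)[of c s t] by (auto simp: Expr_def bin_tag_def)
  qed
  have "P x" if "Frm x" for x
    using that
  proof (induct rule: Frm_induct)
    case definable show ?case by (rule P)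
  next
    case (eq s t) then show ?case using bin[of 5 s t] T[of s] T[of t] by (simp add: Expr_def)
  next
    case (neg p) then show ?case using un[of 6 p] by (simp add: Expr_def)
  next
    case (or p q) then show ?case using bin[of 7 p q] by (simp add: Expr_def)
  next
    case (ex v p) then show ?case using assms(7)[of v p] by (simp add: Expr_def)
  qed
  then show ?thesis using T x unfolding Expr_def by blast
qed

section \<open>Recursion equations for the graphs of syntactic functions\<close>

lemma Num_rule_mono: "(\<And>z. X z \<Longrightarrow> Y z) \<Longrightarrow> Num_rule X y \<Longrightarrow> Num_rule Y y"
  unfolding Num_rule_def by blast

lemma Val_rule_mono: "(\<And>z. X z \<Longrightarrow> Y z) \<Longrightarrow> Val_rule X y \<Longrightarrow> Val_rule Y y"
  unfolding Val_rule_def by blast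

lemma Sub_rule_mono: "(\<And>z. X z \<Longrightarrow> Y z) \<Longrightarrow> Sub_rule v r X y \<Longrightarrow> Sub_rule v r Y y"
  unfolding Sub_rule_def by blast

text \<open>The rules generate nothing but pairs, so that the definability of the graph carries over to the
  generated set of codes.\<close>

lemma Gen_Num: "Gen Num_rule z \<longleftrightarrow> (\<exists>x n. z = pair_M x n \<and> Num x n)"
proof -
  have "Gen Num_rule z \<Longrightarrow> Num_rule (Gen Num_rule) z" by (rule Gen_rule[OF Num_rule_mono])
  moreover have "\<exists>x n. z = pair_M x n" if "Num_rule X z" for X
    using that unfolding Num_rule_def by (elim disjE exE conjE) blast+
  ultimately show ?thesis unfolding Num_def by blast
qed

lemma Gen_Val: "Gen Val_rule z \<longleftrightarrow> (\<exists>x n. z = pair_M x n \<and> Val x n)"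
proof -
  have "Gen Val_rule z \<Longrightarrow> Val_rule (Gen Val_rule) z" by (rule Gen_rule[OF Val_rule_mono])
  moreover have "\<exists>x n. z = pair_M x n" if "Val_rule X z" for X
    using that unfolding Val_rule_def by (elim disjE exE conjE) blast+
  ultimately show ?thesis unfolding Val_def by blast
qed

lemma Gen_Sub: "Gen (Sub_rule v r) z \<longleftrightarrow> (\<exists>x n. z = pair_M x n \<and> Sub v r x n)"
proof -
  have "Gen (Sub_rule v r) z \<Longrightarrow> Sub_rule v r (Gen (Sub_rule v r)) z" by (rule Gen_rule[OF Sub_rule_mono])
  moreover have "\<exists>x n. z = pair_M x n" if "Sub_rule v r X z" for X
    using that unfolding Sub_rule_def by (elim disjE exE conjE) blast+
  ultimately show ?thesis unfolding Sub_def by blast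
qed

lemma le_code: "c \<noteq> 0 \<Longrightarrow> x \<preceq> code1 c x" "c \<noteq> 0 \<Longrightarrow> x \<preceq> code2 c x y" "c \<noteq> 0 \<Longrightarrow> y \<preceq> code2 c x y"
  by (simp_all add: N.less_imp_le)

lemma Num_unfold:
  "Num x n \<longleftrightarrow> x = \<zero> \<and> n = code1 1 \<zero> \<or> (\<exists>a k. Num a k \<and> x = S a \<and> n = code1 2 k)"
proof -
  have "Gen Num_rule (pair_M x n) \<longleftrightarrow> Num_rule (Gen Num_rule) (pair_M x n)"
  proof (rule Gen_unfold)
    show "dfn (Suc 0) (\<lambda>e. Gen Num_rule (e 0))" unfolding Gen_Num by (intro dfn_intros; simp)
    fix X Y :: "'a \<Rightarrow> bool" and y
    assume *: "\<And>z. z \<prec> y \<Longrightarrow> X z \<Longrightarrow> Y z" and "Num_rule X y"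
    then show "Num_rule Y y" unfolding Num_rule_def
      by (auto intro!: * pair_less simp: le_code)
  qed
  then show ?thesis by (simp add: Num_def Num_rule_def)
qed

lemma Sub_unfold:
  "Sub v r x x' \<longleftrightarrow>
     x = v \<and> x' = r \<or>
     Vr x \<and> x \<noteq> v \<and> x' = x \<or>
     x = code1 1 \<zero> \<and> x' = code1 1 \<zero> \<or>
     (\<exists>c s s'. un_tag c \<and> Sub v r s s' \<and> x = code1 c s \<and> x' = code1 c s') \<or>
     (\<exists>c s s' t t'. bin_tag c \<and> Sub v r s s' \<and> Sub v r t t' \<and> x = code2 c s t \<and> x' = code2 c s' t') \<or>
     (\<exists>p. x = code2 8 v p \<and> x' = code2 8 v p) \<or>
     (\<exists>u p p'. u \<noteq> v \<and> Sub v r p p' \<and> x = code2 8 u p \<and> x' = code2 8 u p')"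
proof -
  have "Gen (Sub_rule v r) (pair_M x x') \<longleftrightarrow> Sub_rule v r (Gen (Sub_rule v r)) (pair_M x x')"
  proof (rule Gen_unfold)
    show "dfn (Suc 0) (\<lambda>e. Gen (Sub_rule v r) (e 0))" unfolding Gen_Sub by (intro dfn_intros; simp)
    fix X Y :: "'a \<Rightarrow> bool" and y
    assume *: "\<And>z. z \<prec> y \<Longrightarrow> X z \<Longrightarrow> Y z" and "Sub_rule v r X y"
    then show "Sub_rule v r Y y" unfolding Sub_rule_def
      by (elim disjE exE conjE) (simp_all add: * pair_less le_code)
  qed
  then show ?thesis unfolding Sub_def[symmetric] Sub_rule_def pair_inject un_tag_def bin_tag_def
    by (rule trans) (safe; blast)
qed

text \<open>A premise of the product rule can have a larger value than the conclusion, if the other factor is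
  zero. The pair of a term and its value is still smaller in the premise, because values are bounded by
  codes of terms.\<close>

lemma Val_le: "Val s a \<Longrightarrow> a \<preceq> s"
proof -
  have "\<forall>a. Val s a \<longrightarrow> a \<preceq> s"
  proof (induct s rule: less_induct_M)
    case 1 show ?case by (intro dfn_intros; simp)
  next
    case (2 s)
    show ?case
    proof (intro allI impI)
      fix a assume Val: "Val s a"
      have "Gen Val_rule (pair_M s a) \<Longrightarrow> Val_rule (Gen Val_rule) (pair_M s a)"
        by (rule Gen_rule[OF Val_rule_mono])
      then have "Val_rule (Gen Val_rule) (pair_M s a)" using Val unfolding Val_def .
      then consider "a = \<zero>" | s' a' where "Val s' a'" "s = code1 2 s'" "a = S a'"
        | s' t' a' b' where "Val s' a'" "Val t' b'" "s = code2 3 s' t'" "a = a' \<oplus> b'"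
        | s' t' a' b' where "Val s' a'" "Val t' b'" "s = code2 4 s' t'" "a = a' \<otimes> b'"
        unfolding Val_rule_def Val_def[symmetric] pair_inject by blast
      then show "a \<preceq> s"
      proof cases
        case 2
        then have "a' \<preceq> s'" using "2.hyps" by simp
        then show ?thesis using 2 by (simp add: succ_le_iff N.le_less_trans)
      next
        case 3
        then have "a' \<preceq> s'" "b' \<preceq> t'" using "2.hyps" by simp_all
        then have "a \<preceq> s' \<oplus> t'" unfolding 3 by (rule N.add_mono)
        also have "\<dots> \<preceq> pair_M s' t'" unfolding pair_M_def
          using N.order_trans[OF square_ge le_add_right] .
        also have "\<dots> \<preceq> s" unfolding 3 code2_def by (rule le_code) simp
        finally show ?thesis .
      next
        case 4
        then have "a' \<preceq> s'" "b' \<preceq> t'" using "2.hyps" by simp_all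
        then have "a \<preceq> s' \<otimes> t'" unfolding 4 by (rule mult_mono_M)
        also have "\<dots> \<preceq> (s' \<oplus> t') \<otimes> (s' \<oplus> t')" by (rule mult_mono_M[OF le_add_right le_add_left])
        also have "\<dots> \<preceq> pair_M s' t'" unfolding pair_M_def by (rule le_add_right)
        also have "\<dots> \<preceq> s" unfolding 4 code2_def by (rule le_code) simp
        finally show ?thesis .
      qed (simp add: zero_le)
    qed
  qed
  then show "Val s a \<Longrightarrow> a \<preceq> s" by blast
qed

text \<open>The square in the pairing function leaves room for \<open>2 * x\<close> below the code of an expression that
  contains \<open>x\<close>.\<close>

lemma double_less_code: assumes "x \<preceq> pair_M s t" "c \<noteq> 0" shows "x \<oplus> x \<preceq> code2 c s t"
proof -
  let ?p = "pair_M s t"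
  obtain k where c: "tag c = S (tag k)" using assms(2) by (cases c) (auto simp: tag.simps)
  let ?s = "S (tag k) \<oplus> ?p"
  have "x \<oplus> x \<preceq> ?p \<oplus> ?p" using assms(1) by (intro N.add_mono)
  also have "\<dots> \<preceq> ?p \<otimes> ?p \<oplus> ?p \<oplus> ?p"  by (simp add: add_assoc le_add_left zero_le)
  also have "\<dots> \<preceq> S ?p \<otimes> S ?p" by (simp add: le_iff_add) (metis add_succ add_zero)
  also have "\<dots> \<preceq> ?s \<otimes> ?s" by (intro mult_mono_M) (simp_all add: le_add_left succ_le_iff less_succ_iff zero_le)
  also have "\<dots> \<preceq> code2 c s t" unfolding code2_def code1_def c pair_M_def[of "S (tag k)"] by (rule le_add_right)
  finally show ?thesis .
qed

lemma pair_less_code2: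
  assumes "a \<preceq> x" "x \<preceq> pair_M s t" "c \<noteq> 0" "x \<prec> code2 c s t"
  shows "pair_M x a \<prec> pair_M (code2 c s t) b"
proof -
  let ?B = "code2 c s t"
  have "x \<oplus> a \<preceq> x \<oplus> x" using assms(1) by (rule add_mono_left)
  also have "\<dots> \<preceq> ?B" using assms(2,3) by (rule double_less_code)
  also have "\<dots> \<preceq> ?B \<oplus> b" by (rule le_add_right)
  finally show ?thesis unfolding pair_M_def
    by (intro N.add_le_less_mono mult_mono_M assms(4))
qed

lemma Val_unfold:
  "Val s a \<longleftrightarrow> s = code1 1 \<zero> \<and> a = \<zero> \<or>
     (\<exists>s' a'. Val s' a' \<and> s = code1 2 s' \<and> a = S a') \<or>
     (\<exists>s' t' a' b'. Val s' a' \<and> Val t' b' \<and>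
        (s = code2 3 s' t' \<and> a = a' \<oplus> b' \<or> s = code2 4 s' t' \<and> a = a' \<otimes> b'))"
proof -
  have "Gen Val_rule (pair_M s a) \<longleftrightarrow> Val_rule (Gen Val_rule) (pair_M s a)"
  proof -
  define G where "G = Gen Val_rule"
  show ?thesis
  proof (rule Gen_unfold_below, fold G_def)
    show "dfn (Suc 0) (\<lambda>e. G (e 0))" unfolding G_def Gen_Val by (intro dfn_intros; simp)
  next
    fix y
    have le: "a \<preceq> s" if "G (pair_M s a)" for s a
      using that Val_le unfolding G_def Val_def by blast
    have less1: "pair_M s a \<prec> pair_M (code1 2 s) (S a)" for s a
      by (simp add: pair_less N.less_imp_le)
    have less2: "pair_M s a \<prec> pair_M (code2 c s t) w" "pair_M t b \<prec> pair_M (code2 c s t) w"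
      if "G (pair_M s a)" "G (pair_M t b)" "c \<noteq> 0" for c s t a b w
      using that by (simp_all add: pair_less_code2 le pair_ge)
    assume "Val_rule G y"
    then consider "y = pair_M (code1 1 \<zero>) \<zero>"
      | s a where "G (pair_M s a)" "y = pair_M (code1 2 s) (S a)"
      | s t a b where "G (pair_M s a)" "G (pair_M t b)" "y = pair_M (code2 3 s t) (a \<oplus> b)"
      | s t a b where "G (pair_M s a)" "G (pair_M t b)" "y = pair_M (code2 4 s t) (a \<otimes> b)"
      unfolding Val_rule_def by blast
    then show "Val_rule (\<lambda>z. z \<prec> y \<and> G z) y"
    proof cases
      case 1 then show ?thesis unfolding Val_rule_def by blast
    next
      case (2 s a)
      then have "pair_M s a \<prec> y \<and> G (pair_M s a)" using less1 by blast
      then show ?thesis using 2(2) unfolding Val_rule_def by blast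
    next
      case (3 s t a b)
      have "pair_M s a \<prec> y \<and> G (pair_M s a)" "pair_M t b \<prec> y \<and> G (pair_M t b)"
        unfolding 3(3) using less2[OF 3(1,2), of 3] 3(1,2) by simp_all
      then show ?thesis using 3(3) unfolding Val_rule_def by blast
    next
      case (4 s t a b)
      have "pair_M s a \<prec> y \<and> G (pair_M s a)" "pair_M t b \<prec> y \<and> G (pair_M t b)"
        unfolding 4(3) using less2[OF 4(1,2), of 4] 4(1,2) by simp_all
      then show ?thesis using 4(3) unfolding Val_rule_def by blast
    qed
  qed (rule Val_rule_mono)
  qed
  then show ?thesis by (simp add: Val_def Val_rule_def)
qed

section \<open>Substitution, numerals and values as functions\<close>

text \<open>The default value zero makes the function total in all its arguments, hence
  definable without restriction to codes of the intended kind.\<close>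

definition the_or_zero :: "('a \<Rightarrow> bool) \<Rightarrow> 'a" where
  "the_or_zero Q = (if \<exists>!y. Q y then THE y. Q y else \<zero>)"

lemma the_or_zero_eq:
  "the_or_zero Q = y \<longleftrightarrow> Q y \<and> (\<forall>z. Q z \<longrightarrow> z = y) \<or>
     \<not> (\<exists>w. Q w \<and> (\<forall>z. Q z \<longrightarrow> z = w)) \<and> \<zero> = y"
proof (cases "\<exists>w. Q w \<and> (\<forall>z. Q z \<longrightarrow> z = w)")
  case True
  then obtain w where w: "Q w" "\<forall>z. Q z \<longrightarrow> z = w" by (elim exE conjE)
  have "(THE y. Q y) = w" by (rule the_equality[where P = Q]) (use w in blast)+
  then have "the_or_zero Q = w" unfolding the_or_zero_def Ex1_def using True by (simp only: if_True)
  then show ?thesis using w by metis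
next
  case False
  then have "the_or_zero Q = \<zero>" unfolding the_or_zero_def Ex1_def by (rule if_not_P)
  then show ?thesis using False by metis
qed

lemma the_or_zero_iff: assumes "\<exists>!y. Q y" shows "Q y \<longleftrightarrow> y = the_or_zero Q"
proof -
  have "the_or_zero Q = (THE y. Q y)" unfolding the_or_zero_def using assms by (rule if_P)
  then show ?thesis using theI'[OF assms] the1_equality[OF assms] by metis
qed

definition inst where "inst v r x = the_or_zero (Sub v r x)"
definition numeral_M where "numeral_M x = the_or_zero (Num x)"
definition value_M where "value_M s = the_or_zero (Val s)"

lemma pdef_inst: "pdef (\<lambda>e. inst (e i) (e j) (e k) = e l)"
  unfolding inst_def the_or_zero_eq by (rule dfn_pdef[of i j k l], intro dfn_intros; simp)
lemma pdef_numeral_M: "pdef (\<lambda>e. numeral_M (e i) = e j)"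
  unfolding numeral_M_def the_or_zero_eq by (rule dfn_pdef[of i j i j], intro dfn_intros; simp)
lemma pdef_value_M: "pdef (\<lambda>e. value_M (e i) = e j)"
  unfolding value_M_def the_or_zero_eq by (rule dfn_pdef[of i j i j], intro dfn_intros; simp)

lemmas dfn_fun_syntax [dfn_intros] =
  dfn_fun_comp3[where g = inst, OF pdef_inst] dfn_fun_comp1[where g = numeral_M, OF pdef_numeral_M]
  dfn_fun_comp1[where g = value_M, OF pdef_value_M]

lemma un_tagD: "un_tag c \<Longrightarrow> c \<noteq> 0 \<and> c \<noteq> 1 \<and> c \<noteq> 3 \<and> c \<noteq> 4 \<and> c \<noteq> 5 \<and> c \<noteq> 7 \<and> c \<noteq> 8 \<and> \<not> bin_tag c"
  by (auto simp: un_tag_def bin_tag_def)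
lemma bin_tagD: "bin_tag c \<Longrightarrow> c \<noteq> 0 \<and> c \<noteq> 1 \<and> c \<noteq> 2 \<and> c \<noteq> 6 \<and> c \<noteq> 8 \<and> \<not> un_tag c"
  by (auto simp: un_tag_def bin_tag_def)

lemma code1_eq_code2: "code1 c x = code2 d u v \<longleftrightarrow> c = d \<and> x = pair_M u v"
  "code2 d u v = code1 c x \<longleftrightarrow> c = d \<and> x = pair_M u v"
  by (auto simp: code2_def)

lemma Sub_code:
  assumes v: "Vr v"
  shows "Vr u \<Longrightarrow> Sub v r u y \<longleftrightarrow> y = (if u = v then r else u)"
    and "Sub v r (code1 1 \<zero>) y \<longleftrightarrow> y = code1 1 \<zero>"
    and "un_tag c \<Longrightarrow> Sub v r (code1 c s) y \<longleftrightarrow> (\<exists>s'. Sub v r s s' \<and> y = code1 c s')"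
    and "bin_tag c \<Longrightarrow> Sub v r (code2 c s t) y \<longleftrightarrow>
      (\<exists>s' t'. Sub v r s s' \<and> Sub v r t t' \<and> y = code2 c s' t')"
    and "Sub v r (code2 8 u p) y \<longleftrightarrow>
      (if u = v then y = code2 8 u p else \<exists>p'. Sub v r p p' \<and> y = code2 8 u p')"
proof -
  have u: "\<not> un_tag 0" "\<not> un_tag (Suc 0)" "\<not> bin_tag 0" "\<not> bin_tag (Suc 0)" "\<not> bin_tag 8" "\<not> un_tag 8"
    by (simp_all add: un_tag_def bin_tag_def)
  obtain i where i: "v = code1 0 i" using v by (auto simp: Vr_def)
  have d: "c \<noteq> 0 \<Longrightarrow> code1 c x \<noteq> v" "c \<noteq> 0 \<Longrightarrow> code2 c x z \<noteq> v" for c x z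
    by (simp_all add: i)
  show "Vr u \<Longrightarrow> Sub v r u y \<longleftrightarrow> y = (if u = v then r else u)"
  proof -
    assume "Vr u"
    then obtain j where j: "u = code1 0 j" by (auto simp: Vr_def)
    have f: "\<forall>c x. un_tag c \<longrightarrow> u \<noteq> code1 c x" "\<forall>c x z. bin_tag c \<longrightarrow> u \<noteq> code2 c x z"
      "\<forall>x z. u \<noteq> code2 8 x z" "u \<noteq> code1 1 \<zero>"
      unfolding j by (auto simp: code1_eq_code2 un_tag_def bin_tag_def)
    have "Sub v r u y \<longleftrightarrow> u = v \<and> y = r \<or> Vr u \<and> u \<noteq> v \<and> y = u"
      unfolding Sub_unfold[of v r u y] using f by blast
    then show ?thesis using \<open>Vr u\<close> by simp
  qed
  show "Sub v r (code1 1 \<zero>) y \<longleftrightarrow> y = code1 1 \<zero>"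
    unfolding Sub_unfold[of v r "code1 1 \<zero>" y] using u d(1)[of 1 \<zero>] by (auto simp: code1_eq_code2)
  show "un_tag c \<Longrightarrow> Sub v r (code1 c s) y \<longleftrightarrow> (\<exists>s'. Sub v r s s' \<and> y = code1 c s')"
    unfolding Sub_unfold[of v r "code1 c s" y] using d(1)[of c s] un_tagD[of c] bin_tagD[of c]
    by (auto simp: code1_eq_code2)
  show "bin_tag c \<Longrightarrow> Sub v r (code2 c s t) y \<longleftrightarrow>
      (\<exists>s' t'. Sub v r s s' \<and> Sub v r t t' \<and> y = code2 c s' t')"
    unfolding Sub_unfold[of v r "code2 c s t" y] using d(2)[of c s t] un_tagD[of c] bin_tagD[of c]
    by (auto simp: code1_eq_code2 Vr_code)
  show "Sub v r (code2 8 u p) y \<longleftrightarrow>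
      (if u = v then y = code2 8 u p else \<exists>p'. Sub v r p p' \<and> y = code2 8 u p')"
    unfolding Sub_unfold[of v r "code2 8 u p" y] using u d(2)[of 8 u p]
    by (auto simp: code1_eq_code2)
qed

lemma Sub_total:
  assumes v: "Vr v" and x: "Expr x" shows "\<exists>!y. Sub v r x y"
proof -
  have "\<exists>y. Sub v r x y \<and> (\<forall>z. Sub v r x z \<longrightarrow> z = y)"
    using x
  proof (induct rule: Expr_induct)
    case definable show ?case by (intro dfn_intros; simp)
  next
    case (un c s)
    then obtain y where y: "Sub v r s y" "\<And>z. Sub v r s z \<Longrightarrow> z = y" by blast
    then show ?case unfolding Sub_code(3)[OF v un(1)] by (intro exI[of _ "code1 c y"]) blast
  next
    case (bin c s t)
    then obtain y z where y: "Sub v r s y" "\<And>w. Sub v r s w \<Longrightarrow> w = y"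
      and z: "Sub v r t z" "\<And>w. Sub v r t w \<Longrightarrow> w = z" by blast
    then show ?case unfolding Sub_code(4)[OF v bin(1)] by (intro exI[of _ "code2 c y z"]) blast
  next
    case (ex u p)
    then obtain y where y: "Sub v r p y" "\<And>z. Sub v r p z \<Longrightarrow> z = y" by blast
    show ?case
    proof (cases "u = v")
      case True then show ?thesis unfolding Sub_code(5)[OF v] if_P[OF True] by blast
    next
      case False
      show ?thesis unfolding Sub_code(5)[OF v] if_not_P[OF False]
        by (rule exI[of _ "code2 8 u y"]) (use y in blast)
    qed
  next
    case (var u) then show ?case unfolding Sub_code(1)[OF v var] by blast
  next
    case zero show ?case unfolding Sub_code(2)[OF v] by blast
  qed
  then show ?thesis by blast
qed

lemma Sub_iff: "Vr v \<Longrightarrow> Expr x \<Longrightarrow> Sub v r x y \<longleftrightarrow> y = inst v r x"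
  unfolding inst_def by (rule the_or_zero_iff[OF Sub_total])

lemma inst_code:
  assumes v: "Vr v"
  shows "Vr u \<Longrightarrow> inst v r u = (if u = v then r else u)"
    and "inst v r (code1 1 \<zero>) = code1 1 \<zero>"
    and "un_tag c \<Longrightarrow> Expr s \<Longrightarrow> inst v r (code1 c s) = code1 c (inst v r s)"
    and "bin_tag c \<Longrightarrow> Expr s \<Longrightarrow> Expr t \<Longrightarrow> inst v r (code2 c s t) = code2 c (inst v r s) (inst v r t)"
    and "Expr p \<Longrightarrow> inst v r (code2 8 u p) = (if u = v then code2 8 u p else code2 8 u (inst v r p))"
proof -
  have eq: "inst v r x = y" if *: "\<And>z. Sub v r x z \<longleftrightarrow> z = y" for x y
  proof -
    have "\<exists>!z. Sub v r x z" "Sub v r x y" unfolding * by simp_all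
    then show ?thesis using the_or_zero_iff[of "Sub v r x" y] unfolding inst_def by simp
  qed
  note iff = Sub_iff[OF v]
  show "Vr u \<Longrightarrow> inst v r u = (if u = v then r else u)" by (rule eq) (rule Sub_code(1)[OF v])
  show "inst v r (code1 1 \<zero>) = code1 1 \<zero>" by (rule eq) (rule Sub_code(2)[OF v])
  show "un_tag c \<Longrightarrow> Expr s \<Longrightarrow> inst v r (code1 c s) = code1 c (inst v r s)"
    by (rule eq) (simp add: Sub_code(3)[OF v] iff)
  show "bin_tag c \<Longrightarrow> Expr s \<Longrightarrow> Expr t \<Longrightarrow> inst v r (code2 c s t) = code2 c (inst v r s) (inst v r t)"
    by (rule eq) (simp add: Sub_code(4)[OF v] iff)
  show "Expr p \<Longrightarrow> inst v r (code2 8 u p) = (if u = v then code2 8 u p else code2 8 u (inst v r p))"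
    by (rule eq) (simp add: Sub_code(5)[OF v] iff)
qed

lemma Expr_Trm: "Trm x \<Longrightarrow> Expr x" and Expr_Frm: "Frm x \<Longrightarrow> Expr x"
  by (simp_all add: Expr_def)

lemma inst_Trm: assumes "Trm x" "Vr v" "Trm r" shows "Trm (inst v r x)"
  using assms(1)
proof (induct rule: Trm_induct)
  case definable show ?case by (intro dfn_intros; simp)
next
  case (bin c s t)
  then have "bin_tag c" by (auto simp: bin_tag_def)
  then show ?case using bin by (auto simp: inst_code[OF assms(2)] Expr_Trm)
qed (use assms(2,3) in \<open>simp_all add: inst_code[OF assms(2)] inst_code(2)[OF assms(2), simplified] Expr_Trm\<close>)

lemma inst_Frm: assumes "Frm x" "Vr v" "Trm r" shows "Frm (inst v r x)"
  using assms(1)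
proof (induct rule: Frm_induct)
  case definable show ?case by (intro dfn_intros; simp)
qed (use assms(2,3) in \<open>simp_all add: inst_code[OF assms(2)] Expr_Trm Expr_Frm inst_Trm\<close>)

lemma inst_Expr: "Expr x \<Longrightarrow> Vr v \<Longrightarrow> Trm r \<Longrightarrow> Expr (inst v r x)"
  unfolding Expr_def using inst_Trm inst_Frm by blast

lemma inst_fresh: assumes "Expr x" "Vr v" "\<not> Occ v x" shows "inst v r x = x"
proof -
  have "\<not> Occ v x \<longrightarrow> inst v r x = x"
    using assms(1)
  proof (induct rule: Expr_induct)
    case definable show ?case by (intro dfn_intros; simp)
  qed (use assms(2) in \<open>auto simp: inst_code[OF assms(2)] inst_code(2)[OF assms(2), simplified]\<close>)
  then show ?thesis using assms by blast
qed

lemma Occ_inst: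
  assumes "Expr x" "Vr v" "Vr u" "ClosedTrm r" "Occ u (inst v r x)" shows "u \<noteq> v \<and> Occ u x"
proof -
  have r: "\<not> Occ u r" using assms by (auto simp: ClosedTrm_def)
  have "Occ u (inst v r x) \<longrightarrow> u \<noteq> v \<and> Occ u x"
    using assms(1)
  proof (induct rule: Expr_induct)
    case definable show ?case by (intro dfn_intros; simp)
  qed (use assms(2,3) r in \<open>auto simp: inst_code[OF assms(2)] inst_code(2)[OF assms(2), simplified]\<close>)
  then show ?thesis using assms by blast
qed

lemma inst_closed: "ClosedTrm s \<Longrightarrow> Vr v \<Longrightarrow> inst v r s = s"
  by (rule inst_fresh) (auto simp: ClosedTrm_def Expr_Trm)

text \<open>Both terms being closed, neither substitution creates occurrences of the other variable.\<close>

lemma inst_commute: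
  assumes "Expr x" "Vr v" "Vr u" "u \<noteq> v" "ClosedTrm r" "ClosedTrm s"
  shows "inst v r (inst u s x) = inst u s (inst v r x)"
  using assms(1)
proof (induct rule: Expr_induct)
  case definable show ?case by (intro dfn_intros; simp)
next
  case (var w)
  then show ?case using assms inst_closed by (simp add: inst_code)
next
  case zero
  then show ?case using assms by (simp only: inst_code)
next
  case (un c t)
  then show ?case using assms inst_Expr by (simp add: inst_code ClosedTrm_def)
next
  case (bin c t t')
  then show ?case using assms inst_Expr by (simp add: inst_code ClosedTrm_def)
next
  case (ex w p)
  then show ?case using assms inst_Expr by (simp add: inst_code ClosedTrm_def)
qed

lemma Num_zero: "Num \<zero> n \<longleftrightarrow> n = code1 1 \<zero>"
  and Num_succ: "Num (S x) n \<longleftrightarrow> (\<exists>k. Num x k \<and> n = code1 2 k)"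
  by (subst Num_unfold, simp)+

lemma Num_total: "\<exists>!n. Num x n"
proof -
  have "\<exists>n. Num x n \<and> (\<forall>m. Num x m \<longrightarrow> m = n)"
  proof (induct x rule: pa_induct)
    case 1 show ?case by (intro dfn_intros; simp)
  next
    case (3 x)
    then obtain n where n: "Num x n" "\<And>m. Num x m \<Longrightarrow> m = n" by blast
    show ?case unfolding Num_succ by (intro exI[of _ "code1 2 n"]) (use n in blast)
  qed (simp add: Num_zero)
  then show ?thesis by blast
qed

lemma Num_iff: "Num x n \<longleftrightarrow> n = numeral_M x"
  unfolding numeral_M_def by (rule the_or_zero_iff[OF Num_total])

lemma numeral_M_closed: "ClosedTrm (numeral_M x)"
proof -
  have "Trm (numeral_M x) \<and> (\<forall>v. Vr v \<longrightarrow> \<not> Occ v (numeral_M x))"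
  proof (induct x rule: pa_induct)
    case 1 show ?case by (intro dfn_intros; simp)
  next
    case 2
    have "numeral_M \<zero> = code1 1 \<zero>" using Num_zero[of "numeral_M \<zero>"] unfolding Num_iff by simp
    then show ?case by simp
  next
    case (3 x)
    have "numeral_M (S x) = code1 2 (numeral_M x)"
      using Num_succ[of x "numeral_M (S x)"] unfolding Num_iff by simp
    then show ?case using 3 by simp
  qed
  then show ?thesis by (simp add: ClosedTrm_def)
qed

lemma Val_code:
  "Val (code1 1 \<zero>) a \<longleftrightarrow> a = \<zero>"
  "Val (code1 2 s) a \<longleftrightarrow> (\<exists>a'. Val s a' \<and> a = S a')"
  "Val (code2 3 s t) a \<longleftrightarrow> (\<exists>a' b'. Val s a' \<and> Val t b' \<and> a = a' \<oplus> b')"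
  "Val (code2 4 s t) a \<longleftrightarrow> (\<exists>a' b'. Val s a' \<and> Val t b' \<and> a = a' \<otimes> b')"
proof -
  show "Val (code1 1 \<zero>) a \<longleftrightarrow> a = \<zero>"
    unfolding Val_unfold[of "code1 1 \<zero>" a] by simp
  show "Val (code1 2 s) a \<longleftrightarrow> (\<exists>a'. Val s a' \<and> a = S a')"
    unfolding Val_unfold[of "code1 2 s" a] by simp
  show "Val (code2 3 s t) a \<longleftrightarrow> (\<exists>a' b'. Val s a' \<and> Val t b' \<and> a = a' \<oplus> b')"
    unfolding Val_unfold[of "code2 3 s t" a] by simp blast
  show "Val (code2 4 s t) a \<longleftrightarrow> (\<exists>a' b'. Val s a' \<and> Val t b' \<and> a = a' \<otimes> b')"
    unfolding Val_unfold[of "code2 4 s t" a] by simp blast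
qed

lemma ClosedTrm_code:
  "ClosedTrm (code1 2 s) \<longleftrightarrow> ClosedTrm s"
  "ClosedTrm (code2 3 s t) \<longleftrightarrow> ClosedTrm s \<and> ClosedTrm t"
  "ClosedTrm (code2 4 s t) \<longleftrightarrow> ClosedTrm s \<and> ClosedTrm t"
  "\<not> (Vr v \<and> ClosedTrm v)"
  by (auto simp: ClosedTrm_def)

lemma pdef_ClosedTrm: "pdef (\<lambda>e. ClosedTrm (e i))"
  unfolding ClosedTrm_def by (rule dfn_pdef[of i i i i], intro dfn_intros; simp)
lemmas dfn_ClosedTrm [dfn_intros] = dfn_comp1[where P = ClosedTrm, OF pdef_ClosedTrm]

lemma Val_total: assumes "ClosedTrm s" shows "\<exists>!a. Val s a"
proof -
  have "Trm s" using assms by (simp add: ClosedTrm_def)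
  then have "ClosedTrm s \<longrightarrow> (\<exists>a. Val s a \<and> (\<forall>b. Val s b \<longrightarrow> b = a))"
  proof (induct rule: Trm_induct)
    case definable show ?case by (intro dfn_intros; simp)
  next
    case (bin c s t)
    show ?case
    proof
      assume "ClosedTrm (code2 c s t)"
      with bin(1) have "ClosedTrm s" "ClosedTrm t"
        by (elim disjE; simp add: ClosedTrm_code)+
      then obtain a b where ab: "Val s a" "\<forall>a'. Val s a' \<longrightarrow> a' = a"
        "Val t b" "\<forall>b'. Val t b' \<longrightarrow> b' = b"
        using bin(4,5) by (elim impE exE conjE)
      show "\<exists>a. Val (code2 c s t) a \<and> (\<forall>b. Val (code2 c s t) b \<longrightarrow> b = a)"
        using bin(1)
      proof
        assume c: "c = 3"
        show ?thesis unfolding c Val_code by (rule exI[of _ "a \<oplus> b"]) (use ab in blast)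
      next
        assume c: "c = 4"
        show ?thesis unfolding c Val_code by (rule exI[of _ "a \<otimes> b"]) (use ab in blast)
      qed
    qed
  next
    case (succ s)
    then show ?case unfolding Val_code ClosedTrm_code by blast
  next
    case (var v) then show ?case using ClosedTrm_code(4) by blast
  next
    case zero show ?case unfolding Val_code by blast
  qed
  then show ?thesis using assms by blast
qed

lemma Val_iff: "ClosedTrm s \<Longrightarrow> Val s a \<longleftrightarrow> a = value_M s"
  unfolding value_M_def by (rule the_or_zero_iff[OF Val_total])

lemma value_M_code:
  "ClosedTrm s \<Longrightarrow> value_M (code1 2 s) = S (value_M s)"
  "ClosedTrm s \<Longrightarrow> ClosedTrm t \<Longrightarrow> value_M (code2 3 s t) = value_M s \<oplus> value_M t"
  "ClosedTrm s \<Longrightarrow> ClosedTrm t \<Longrightarrow> value_M (code2 4 s t) = value_M s \<otimes> value_M t"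
  using Val_iff[of "code1 2 s" "S (value_M s)"] Val_iff[of "code2 3 s t" "value_M s \<oplus> value_M t"]
    Val_iff[of "code2 4 s t" "value_M s \<otimes> value_M t"] Val_iff[of s "value_M s"] Val_iff[of t "value_M t"]
  unfolding Val_code ClosedTrm_code by metis+

text \<open>The value of a term depends on the substituted closed term through its value only.
  The induction has to carry along that both instances are closed, since a term with
  variables has no value.\<close>

lemma value_M_inst:
  assumes "Trm x" "Vr v" and x: "\<And>u. Vr u \<Longrightarrow> Occ u x \<Longrightarrow> u = v"
    and st: "ClosedTrm s" "ClosedTrm t" "value_M s = value_M t"
  shows "value_M (inst v s x) = value_M (inst v t x)"
proof -
  have "(\<forall>u. Vr u \<and> Occ u x \<longrightarrow> u = v) \<longrightarrow>
    ClosedTrm (inst v s x) \<and> ClosedTrm (inst v t x) \<and> value_M (inst v s x) = value_M (inst v t x)"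
    using assms(1)
  proof (induct rule: Trm_induct)
    case definable show ?case by (intro dfn_intros; simp)
  next
    case (var u) then show ?case using st assms(2) by (auto simp: inst_code)
  next
    case zero show ?case using assms(2) by (simp add: inst_code(2)[simplified] ClosedTrm_def)
  next
    case (succ x)
    then show ?case using assms(2) by (auto simp: inst_code Expr_Trm ClosedTrm_code value_M_code)
  next
    case (bin c x y)
    then have c: "bin_tag c" by (auto simp: bin_tag_def)
    then show ?case using bin assms(2) by (auto simp: inst_code Expr_Trm ClosedTrm_code value_M_code)
  qed
  then show ?thesis using x by blast
qed

section \<open>Truth for sentences of standard depth\<close>

text \<open>The number \<open>k\<close> is an actual natural number, whereas \<open>y\<close> may be a nonstandard formula. As all
  equations are included from the first level on, only the depth of the logical structure counts and
  not the size of terms.\<close>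

fun depth_below :: "nat \<Rightarrow> 'a \<Rightarrow> bool" where
  "depth_below 0 y \<longleftrightarrow> False"
| "depth_below (Suc k) y \<longleftrightarrow>
     (\<exists>s t. Trm s \<and> Trm t \<and> y = code2 5 s t) \<or>
     (\<exists>p. depth_below k p \<and> y = code1 6 p) \<or>
     (\<exists>p q. depth_below k p \<and> depth_below k q \<and> y = code2 7 p q) \<or>
     (\<exists>v p. Vr v \<and> depth_below k p \<and> y = code2 8 v p)"

text \<open>Tarski's definition of truth for closed sentences, restricted to depth below \<open>k\<close>; the
  quantifier ranges over all numerals of the model.\<close>

fun true_below :: "nat \<Rightarrow> 'a \<Rightarrow> bool" where
  "true_below 0 y \<longleftrightarrow> False"
| "true_below (Suc k) y \<longleftrightarrow> Sent y \<and> depth_below (Suc k) y \<and>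
     ((\<exists>s t. y = code2 5 s t \<and> value_M s = value_M t) \<or>
      (\<exists>p. y = code1 6 p \<and> \<not> true_below k p) \<or>
      (\<exists>p q. y = code2 7 p q \<and> (true_below k p \<or> true_below k q)) \<or>
      (\<exists>v p. y = code2 8 v p \<and> (\<exists>x. true_below k (inst v (numeral_M x) p))))"

lemma depth_below_code [simp]:
  "depth_below (Suc k) (code2 5 s t) \<longleftrightarrow> Trm s \<and> Trm t"
  "depth_below (Suc k) (code1 6 p) \<longleftrightarrow> depth_below k p"
  "depth_below (Suc k) (code2 7 p q) \<longleftrightarrow> depth_below k p \<and> depth_below k q"
  "depth_below (Suc k) (code2 8 v p) \<longleftrightarrow> Vr v \<and> depth_below k p"
  by simp_all

lemma true_below_code [simp]:
  "true_below (Suc k) (code2 5 s t) \<longleftrightarrow> Sent (code2 5 s t) \<and> Trm s \<and> Trm t \<and> value_M s = value_M t"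
  "true_below (Suc k) (code1 6 p) \<longleftrightarrow> Sent (code1 6 p) \<and> depth_below k p \<and> \<not> true_below k p"
  "true_below (Suc k) (code2 7 p q) \<longleftrightarrow> Sent (code2 7 p q) \<and> depth_below k p \<and> depth_below k q \<and> (true_below k p \<or> true_below k q)"
  "true_below (Suc k) (code2 8 v p) \<longleftrightarrow> Sent (code2 8 v p) \<and> Vr v \<and> depth_below k p \<and> (\<exists>x. true_below k (inst v (numeral_M x) p))"
  by auto

lemma depth_below_cases [consumes 1, case_names eq neg or ex]:
  assumes "depth_below k y"
  obtains j s t where "k = Suc j" "y = code2 5 s t" "Trm s" "Trm t"
    | j p where "k = Suc j" "y = code1 6 p" "depth_below j p"
    | j p q where "k = Suc j" "y = code2 7 p q" "depth_below j p" "depth_below j q"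
    | j v p where "k = Suc j" "y = code2 8 v p" "Vr v" "depth_below j p"
proof (cases k)
  case 0 then show thesis using assms by simp
next
  case (Suc j) then show thesis using assms that by (simp only: depth_below.simps) blast
qed

declare true_below.simps(2) [simp del] depth_below.simps(2) [simp del]

lemma pdef_Sent: "pdef (\<lambda>e. Sent (e i))"
  unfolding Sent_def by (rule dfn_pdef[of i i i i], intro dfn_intros; simp)
lemmas dfn_Sent [dfn_intros] = dfn_comp1[where P = Sent, OF pdef_Sent]

lemma pdef_depth_below: "pdef (\<lambda>e. depth_below k (e i))"
proof (induction k arbitrary: i)
  case 0 show ?case by (rule dfn_pdef[of 0 0 0 0]) (simp add: dfn_const)
next
  case (Suc k)
  note [dfn_intros] = dfn_comp1[where P = "depth_below k", OF Suc.IH]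
  show ?case unfolding depth_below.simps(2) by (rule dfn_pdef[of i i i i], intro dfn_intros; simp)
qed
lemmas dfn_depth_below [dfn_intros] = dfn_comp1[where P = "depth_below k" for k, OF pdef_depth_below]

text \<open>Unfolding the recursion \<open>k\<close> times yields an arithmetical formula, so the truth predicate for each
  standard depth is definable. The union over all \<open>k\<close> is not, by Tarski's theorem.\<close>

lemma pdef_true_below: "pdef (\<lambda>e. true_below k (e i))"
proof (induction k arbitrary: i)
  case 0 show ?case by (rule dfn_pdef[of 0 0 0 0]) (simp add: dfn_const)
next
  case (Suc k)
  note [dfn_intros] = dfn_comp1[where P = "true_below k", OF Suc.IH]
  show ?case unfolding true_below.simps(2) by (rule dfn_pdef[of i i i i], intro dfn_intros; simp)
qed
lemmas dfn_true_below [dfn_intros] = dfn_comp1[where P = "true_below k" for k, OF pdef_true_below]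

lemma Sent_code:
  "Sent (code2 5 s t) \<longleftrightarrow> ClosedTrm s \<and> ClosedTrm t"
  "Sent (code1 6 p) \<longleftrightarrow> Sent p"
  "Sent (code2 7 p q) \<longleftrightarrow> Sent p \<and> Sent q"
  "Sent (code2 8 v p) \<longleftrightarrow> Frm_in v p"
  by (auto simp: Sent_def ClosedTrm_def Frm_in_def)

lemma Frm_in_code:
  "Frm_in v (code2 5 s t) \<longleftrightarrow> Vr v \<and> Trm s \<and> Trm t \<and> (\<forall>u. Vr u \<and> (Occ u s \<or> Occ u t) \<longrightarrow> u = v)"
  "Frm_in v (code1 6 p) \<longleftrightarrow> Frm_in v p"
  "Frm_in v (code2 7 p q) \<longleftrightarrow> Frm_in v p \<and> Frm_in v q"
  by (auto simp: Frm_in_def)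

lemma Sent_inst: "Frm_in v p \<Longrightarrow> ClosedTrm r \<Longrightarrow> Sent (inst v r p)"
proof -
  assume p: "Frm_in v p" and r: "ClosedTrm r"
  then have f: "Frm p" "Vr v" "Trm r" by (simp_all add: Frm_in_def ClosedTrm_def)
  have "\<not> Occ u (inst v r p)" if "Vr u" for u
  proof
    assume "Occ u (inst v r p)"
    then have "u \<noteq> v \<and> Occ u p" by (rule Occ_inst[OF Expr_Frm[OF f(1)] f(2) that r])
    then show False using p that unfolding Frm_in_def by blast
  qed
  then show ?thesis using inst_Frm[OF f] unfolding Sent_def by blast
qed

text \<open>For the step from a quantified formula to its instances: one free variable \<open>v\<close> remains.\<close>

lemma Frm_in_inst:
  assumes "Frm_in v (code2 8 u p)" "Vr u" "u \<noteq> v" "ClosedTrm r" shows "Frm_in v (inst u r p)"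
proof -
  have f: "Frm (code2 8 u p)" and v: "Vr v"
    and *: "\<forall>w. Vr w \<and> Occ w (code2 8 u p) \<longrightarrow> w = v"
    using assms(1) unfolding Frm_in_def by blast+
  have p: "Frm p" using f by simp
  have "w = v" if "Vr w" "Occ w (inst u r p)" for w
  proof -
    have "w \<noteq> u \<and> Occ w p"
      by (rule Occ_inst[OF Expr_Frm[OF p] \<open>Vr u\<close> that(1) \<open>ClosedTrm r\<close> that(2)])
    then have "Occ w (code2 8 u p)" using that(1) by auto
    then show ?thesis using * that(1) by blast
  qed
  moreover have "Frm (inst u r p)" using inst_Frm p assms(2,4) by (simp add: ClosedTrm_def)
  ultimately show ?thesis using v unfolding Frm_in_def by blast
qed

text \<open>If two different variables are allowed as the only free one, the formula is a sentence.\<close>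

lemma inst_unique: "Frm_in v p \<Longrightarrow> Frm_in w p \<Longrightarrow> inst v r p = inst w r p"
proof (cases "v = w")
  case False
  assume "Frm_in v p" "Frm_in w p"
  then have "Expr p" "Vr v" "Vr w" "\<not> Occ v p" "\<not> Occ w p"
    using False unfolding Frm_in_def Expr_def by blast+
  then show ?thesis by (simp add: inst_fresh)
qed simp

lemma Sent_Frm_in: "Sent p \<Longrightarrow> Frm_in (code1 0 \<zero>) p"
  by (auto simp: Sent_def Frm_in_def)

lemma depth_below_Frm: "depth_below k p \<Longrightarrow> Frm p"
proof (induction k arbitrary: p)
  case (Suc k) from Suc.prems show ?case by (cases rule: depth_below_cases) (use Suc.IH in auto)
qed simp

lemma depth_below_Suc: "depth_below k p \<Longrightarrow> depth_below (Suc k) p"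
proof (induction k arbitrary: p)
  case (Suc k) from Suc.prems show ?case by (cases rule: depth_below_cases) (use Suc.IH in auto)
qed simp

lemma depth_below_add: "depth_below k p \<Longrightarrow> depth_below (k + i) p"
  by (induction i) (simp_all add: depth_below_Suc)

text \<open>Instances have the depth of the formula. This is what makes \<open>tot\<close> equivalent to
  standard depth and gives one definable truth predicate for all instances of a formula.\<close>

lemma depth_below_inst: "Frm p \<Longrightarrow> Vr v \<Longrightarrow> Trm r \<Longrightarrow> depth_below k (inst v r p) \<longleftrightarrow> depth_below k p"
proof (induction k arbitrary: p)
  case (Suc k)
  from \<open>Frm p\<close> show ?case
    by (subst (asm) Frm_unfold)
      (use Suc in \<open>auto simp: inst_code Expr_Trm Expr_Frm inst_Trm split: if_splits\<close>)
qed simp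

lemma true_below_depth_below: "true_below k p \<Longrightarrow> depth_below k p"
  by (cases k) (simp_all add: true_below.simps(2))

text \<open>The truth predicates for different depths agree where both apply.\<close>

lemma true_below_Suc: "depth_below k p \<Longrightarrow> true_below (Suc k) p \<longleftrightarrow> true_below k p"
proof (induction k arbitrary: p)
  case (Suc k)
  from Suc.prems show ?case
  proof (cases rule: depth_below_cases)
    case (ex j v q)
    have "depth_below k (inst v (numeral_M x) q)" for x
      using ex depth_below_inst[OF depth_below_Frm[of k q], of v "numeral_M x"] numeral_M_closed[of x] by (simp add: ClosedTrm_def)
    then show ?thesis using ex Suc.IH by (simp add: depth_below_Suc)
  qed (use Suc.IH in \<open>auto simp: depth_below_Suc\<close>)
qed simp

lemma true_below_add: "depth_below k p \<Longrightarrow> true_below (k + i) p \<longleftrightarrow> true_below k p"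
  by (induction i) (simp_all add: true_below_Suc depth_below_add)

definition "std_depth p \<longleftrightarrow> (\<exists>k. depth_below k p)"
definition "Truth = {p. \<exists>k. true_below k p}"

lemma Truth_iff: assumes "depth_below k p" shows "p \<in> Truth \<longleftrightarrow> true_below k p"
proof -
  have "true_below k p" if "true_below j p" for j
    using that true_below_add[OF assms, of j] true_below_add[OF true_below_depth_below[OF that], of k] by (simp add: add.commute)
  then show ?thesis by (auto simp: Truth_def)
qed

lemma Truth_std_depth: "p \<in> Truth \<Longrightarrow> std_depth p"
  using true_below_depth_below by (auto simp: Truth_def std_depth_def)

lemma std_depth_Suc: "std_depth p \<longleftrightarrow> (\<exists>k. depth_below (Suc k) p)"
proof
  assume "std_depth p"
  then obtain k where "depth_below k p" unfolding std_depth_def ..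
  then show "\<exists>k. depth_below (Suc k) p" by (intro exI) (rule depth_below_Suc)
next
  assume "\<exists>k. depth_below (Suc k) p"
  then show "std_depth p" unfolding std_depth_def by blast
qed

lemma std_depth_common: "std_depth p \<Longrightarrow> std_depth q \<Longrightarrow> \<exists>k. depth_below k p \<and> depth_below k q"
proof -
  assume "std_depth p" "std_depth q"
  then obtain j k where "depth_below j p" "depth_below k q" unfolding std_depth_def by blast
  then have "depth_below (j + k) p" "depth_below (j + k) q" using depth_below_add[of j p k] depth_below_add[of k q j] by (simp_all add: add.commute)
  then show ?thesis by blast
qed

lemma std_depth_code:
  "std_depth (code2 5 s t) \<longleftrightarrow> Trm s \<and> Trm t"
  "std_depth (code1 6 p) \<longleftrightarrow> std_depth p"
  "std_depth (code2 7 p q) \<longleftrightarrow> std_depth p \<and> std_depth q"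
  "std_depth (code2 8 v p) \<longleftrightarrow> Vr v \<and> std_depth p"
proof -
  show "std_depth (code2 7 p q) \<longleftrightarrow> std_depth p \<and> std_depth q"
    unfolding std_depth_Suc[of "code2 7 p q"] depth_below_code using std_depth_common[of p q] unfolding std_depth_def by blast
qed (simp_all add: std_depth_Suc[of "code2 5 s t"] std_depth_Suc[of "code1 6 p"] std_depth_Suc[of "code2 8 v p"], simp_all add: std_depth_def)

lemma std_depth_inst: "Frm p \<Longrightarrow> Vr v \<Longrightarrow> Trm r \<Longrightarrow> std_depth (inst v r p) \<longleftrightarrow> std_depth p"
  by (simp add: std_depth_def depth_below_inst)

lemma Truth_eq: "ClosedTrm s \<Longrightarrow> ClosedTrm t \<Longrightarrow> code2 5 s t \<in> Truth \<longleftrightarrow> value_M s = value_M t"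
  using Truth_iff[of "Suc 0" "code2 5 s t"] by (simp add: Sent_code ClosedTrm_def)

text \<open>Outside of standard depth, neither \<open>p\<close> nor its negation is true.\<close>

lemma Truth_neg: "Sent p \<Longrightarrow> code1 6 p \<in> Truth \<longleftrightarrow> std_depth p \<and> p \<notin> Truth"
proof (cases "std_depth p")
  case True
  assume "Sent p"
  obtain k where "depth_below k p" using True by (auto simp: std_depth_def)
  then show ?thesis using Truth_iff[of "Suc k" "code1 6 p"] Truth_iff[of k p] True \<open>Sent p\<close>
    by (simp add: Sent_code)
next
  case False
  then show ?thesis using Truth_std_depth[of "code1 6 p"] by (auto simp: std_depth_code)
qed

lemma Truth_or:
  assumes "Sent p" "Sent q"
  shows "code2 7 p q \<in> Truth \<longleftrightarrow> std_depth p \<and> std_depth q \<and> (p \<in> Truth \<or> q \<in> Truth)"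
proof (cases "std_depth p \<and> std_depth q")
  case True
  then obtain k where "depth_below k p" "depth_below k q" using std_depth_common by blast
  then show ?thesis
    using Truth_iff[of "Suc k" "code2 7 p q"] Truth_iff[of k p] Truth_iff[of k q] True assms
    by (simp add: Sent_code)
next
  case False
  then show ?thesis using Truth_std_depth[of "code2 7 p q"] by (auto simp: std_depth_code)
qed

lemma Truth_ex:
  assumes "Frm_in v p"
  shows "code2 8 v p \<in> Truth \<longleftrightarrow> std_depth p \<and> (\<exists>x. inst v (numeral_M x) p \<in> Truth)"
proof (cases "std_depth p")
  case True
  then obtain k where k: "depth_below k p" by (auto simp: std_depth_def)
  have v: "Vr v" "Frm p" using assms by (simp_all add: Frm_in_def)
  have "depth_below k (inst v (numeral_M x) p)" for x
    using k v numeral_M_closed[of x] depth_below_inst[of p v "numeral_M x" k] by (simp add: ClosedTrm_def)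
  then have "inst v (numeral_M x) p \<in> Truth \<longleftrightarrow> true_below k (inst v (numeral_M x) p)" for x by (rule Truth_iff)
  then show ?thesis
    using Truth_iff[of "Suc k" "code2 8 v p"] k v True assms
    by (simp add: Sent_code)
next
  case False
  then show ?thesis using Truth_std_depth[of "code2 8 v p"] by (auto simp: std_depth_code)
qed

text \<open>Equations are the only place where the values of terms matter. In the quantifier step, the
  two substitutions commute and the induction hypothesis applies to each numerical instance.\<close>

lemma true_below_regular:
  assumes st: "ClosedTrm s" "ClosedTrm t" "value_M s = value_M t"
  shows "Frm_in v p \<Longrightarrow> depth_below k p \<Longrightarrow> true_below k (inst v s p) \<longleftrightarrow> true_below k (inst v t p)"
proof (induction k arbitrary: p)
  case (Suc k)
  have v: "Vr v" using Suc.prems by (simp add: Frm_in_def)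
  have tr: "Trm s" "Trm t" using st by (simp_all add: ClosedTrm_def)
  have sent: "Sent (inst v s p)" "Sent (inst v t p)" using Sent_inst Suc.prems st by simp_all
  from Suc.prems(2) show ?case
  proof (cases rule: depth_below_cases)
    case (eq j a b)
    have "value_M (inst v s a) = value_M (inst v t a)" "value_M (inst v s b) = value_M (inst v t b)"
      using Suc.prems(1) eq v st by (auto simp: Frm_in_code intro!: value_M_inst)
    then show ?thesis using eq sent v tr by (simp add: inst_code Expr_Trm inst_Trm)
  next
    case (neg j q)
    then have "true_below k (inst v s q) \<longleftrightarrow> true_below k (inst v t q)" using Suc.prems Suc.IH by (simp add: Frm_in_code)
    then show ?thesis using neg sent v tr by (simp add: inst_code Expr_Frm depth_below_Frm depth_below_inst)
  next
    case (or j q r)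
    then have "true_below k (inst v s q) \<longleftrightarrow> true_below k (inst v t q)" "true_below k (inst v s r) \<longleftrightarrow> true_below k (inst v t r)"
      using Suc.prems Suc.IH by (simp_all add: Frm_in_code)
    then show ?thesis using or sent v tr by (simp add: inst_code Expr_Frm depth_below_Frm depth_below_inst)
  next
    case (ex j u q)
    show ?thesis
    proof (cases "u = v")
      case True then show ?thesis using ex v by (simp add: inst_code Expr_Frm depth_below_Frm)
    next
      case False
      have q: "Frm q" "depth_below k q" using ex depth_below_Frm by simp_all
      have "true_below k (inst u (numeral_M x) (inst v s q)) \<longleftrightarrow> true_below k (inst u (numeral_M x) (inst v t q))" for x
      proof -
        have numeral_M: "Trm (numeral_M x)" using numeral_M_closed by (simp add: ClosedTrm_def)
        have "Frm_in v (inst u (numeral_M x) q)" "depth_below k (inst u (numeral_M x) q)"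
          using Frm_in_inst[of v u q "numeral_M x"] Suc.prems(1) ex False numeral_M numeral_M_closed q by (simp_all add: depth_below_inst)
        then have "true_below k (inst v s (inst u (numeral_M x) q)) \<longleftrightarrow> true_below k (inst v t (inst u (numeral_M x) q))"
          by (rule Suc.IH)
        then show ?thesis
          using inst_commute[of q v u s "numeral_M x"] inst_commute[of q v u t "numeral_M x"] q ex v False st numeral_M_closed
          by (simp add: Expr_Frm)
      qed
      then show ?thesis using ex sent v tr q False by (simp add: inst_code Expr_Frm depth_below_inst)
    qed
  qed
qed simp

lemma Truth_regular:
  assumes "Frm_in v p" "ClosedTrm s" "ClosedTrm t" "value_M s = value_M t"
  shows "inst v s p \<in> Truth \<longleftrightarrow> inst v t p \<in> Truth"
proof (cases "std_depth p")
  have f: "Frm p" "Vr v" "Trm s" "Trm t" using assms by (simp_all add: Frm_in_def ClosedTrm_def)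
  case True
  then obtain k where k: "depth_below k p" by (auto simp: std_depth_def)
  then have "inst v s p \<in> Truth \<longleftrightarrow> true_below k (inst v s p)" "inst v t p \<in> Truth \<longleftrightarrow> true_below k (inst v t p)"
    using f by (simp_all add: Truth_iff depth_below_inst)
  then show ?thesis using true_below_regular[OF assms(2-4,1) k] by simp
next
  have f: "Frm p" "Vr v" "Trm s" "Trm t" using assms by (simp_all add: Frm_in_def ClosedTrm_def)
  case False
  then show ?thesis using Truth_std_depth std_depth_inst f by blast
qed

text \<open>One true instance bounds the depth of \<open>p\<close> by some standard \<open>k\<close>; on the instances of \<open>p\<close>, truth
  then coincides with the definable predicate \<open>true_below k\<close>, so the induction scheme applies.\<close>

lemma Truth_induction:
  assumes "Frm_in v p" and step: "\<And>x. inst v (numeral_M x) p \<in> Truth \<Longrightarrow> inst v (numeral_M (S x)) p \<in> Truth"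
    and zero: "inst v (numeral_M \<zero>) p \<in> Truth"
  shows "inst v (numeral_M x) p \<in> Truth"
proof -
  have f: "Frm p" "Vr v" "Trm (numeral_M x)" for x
    using assms numeral_M_closed by (simp_all add: Frm_in_def ClosedTrm_def)
  have "std_depth p" using Truth_std_depth[OF zero] std_depth_inst[OF f(1,2,3)] by blast
  then obtain k where "depth_below k p" by (auto simp: std_depth_def)
  then have *: "inst v (numeral_M x) p \<in> Truth \<longleftrightarrow> true_below k (inst v (numeral_M x) p)" for x
    using f by (simp add: Truth_iff depth_below_inst)
  have "true_below k (inst v (numeral_M x) p)"
  proof (induct x rule: pa_induct)
    case 1 show ?case by (intro dfn_intros; simp)
  next
    case 2 show ?case using zero unfolding * .
  next
    case (3 x) then show ?case by (rule step[unfolded *])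
  qed
  then show ?thesis unfolding * .
qed

section \<open>The axioms\<close>

text \<open>Shaped to be used as a rewrite rule on the body of \<open>at_term\<close>.\<close>

lemma Sub_in: "Frm_in v p \<and> Sub v r p q \<and> Q \<longleftrightarrow> Frm_in v p \<and> q = inst v r p \<and> Q"
  using Sub_iff[of v p r q] by (auto simp: Frm_in_def Expr_Frm)

lemma sat_at_term [simp]:
  "tbelow n p \<Longrightarrow> tbelow n r \<Longrightarrow> sat M T e (at_term p r \<^bold>T n) \<longleftrightarrow>
    (\<exists>v. Frm_in v (val M e p) \<and> inst v (val M e r) (val M e p) \<in> T)"
  by (simp add: at_term_def Sub_in)

lemma sat_at_num [simp]:
  "tbelow n p \<Longrightarrow> tbelow n x \<Longrightarrow> sat M T e (at_num p x \<^bold>T n) \<longleftrightarrow>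
    (\<exists>v. Frm_in v (val M e p) \<and> inst v (numeral_M (val M e x)) (val M e p) \<in> T)"
  by (simp add: at_num_def Num_iff)

lemma sat_at_num_neg [simp]:
  "tbelow n p \<Longrightarrow> tbelow n x \<Longrightarrow> sat M T e (at_num p x (\<lambda>q. \<^bold>T (cNeg q)) n) \<longleftrightarrow>
    (\<exists>v. Frm_in v (val M e p) \<and> code1 6 (inst v (numeral_M (val M e x)) (val M e p)) \<in> T)"
  by (simp add: at_num_def at_term_def Sub_in Num_iff)

text \<open>The choice of the variable in \<open>at_term\<close> and \<open>at_num\<close> is immaterial.\<close>

lemma inst_iff:
  "Frm_in v p \<Longrightarrow> (\<exists>w. Frm_in w p \<and> Q (inst w r p)) \<longleftrightarrow> Q (inst v r p)"
  using inst_unique by metis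

definition "Tot p \<longleftrightarrow> (\<exists>v. Frm_in v p) \<and> (\<forall>x. (\<exists>v. Frm_in v p \<and> inst v (numeral_M x) p \<in> Truth) \<or>
  (\<exists>v. Frm_in v p \<and> code1 6 (inst v (numeral_M x) p) \<in> Truth))"

lemma sat_tot [simp]: "tbelow n p \<Longrightarrow> sat M Truth e (tot p n) \<longleftrightarrow> Tot (val M e p)"
  by (simp add: tot_def Tot_def)

text \<open>Being total and having standard depth are the same: instances of standard depth are true or
  false, and a single true or false instance has standard depth.\<close>

lemma Tot_iff: assumes "Frm_in v p" shows "Tot p \<longleftrightarrow> std_depth p"
proof -
  have f: "Frm p" "Vr v" "Trm (numeral_M x)" "Sent (inst v (numeral_M x) p)" for x
    using assms numeral_M_closed Sent_inst by (simp_all add: Frm_in_def ClosedTrm_def)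
  have "Tot p \<longleftrightarrow> (\<forall>x. inst v (numeral_M x) p \<in> Truth \<or> code1 6 (inst v (numeral_M x) p) \<in> Truth)"
    unfolding Tot_def using inst_iff[OF assms, of "\<lambda>q. q \<in> Truth"]
      inst_iff[OF assms, of "\<lambda>q. code1 6 q \<in> Truth"] assms by blast
  also have "\<dots> \<longleftrightarrow> std_depth p"
    using Truth_neg[OF f(4)] Truth_std_depth std_depth_inst[OF f(1,2,3)] by blast
  finally show ?thesis .
qed

lemma Tot_Sent: "Sent p \<Longrightarrow> Tot p \<longleftrightarrow> std_depth p"
  by (rule Tot_iff[OF Sent_Frm_in])

lemma sat_ax_eq: "sat M Truth e (ax_eq 0)"
  by (simp add: ax_eq_def Truth_eq Val_iff)

lemma sat_ax_neq: "sat M Truth e (ax_neq 0)"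
  by (simp add: ax_neq_def Truth_eq Truth_neg Sent_code std_depth_code Val_iff ClosedTrm_def)

lemma sat_ax_or: "sat M Truth e (ax_or 0)"
  by (simp add: ax_or_def Truth_or Tot_Sent)

lemma sat_ax_nor: "sat M Truth e (ax_nor 0)"
  by (auto simp: ax_nor_def Truth_or Truth_neg Sent_code std_depth_code)

lemma sat_ax_ex: "sat M Truth e (ax_ex 0)"
proof -
  have "code2 8 v p \<in> Truth \<longleftrightarrow> Tot p \<and> (\<exists>x w. Frm_in w p \<and> inst w (numeral_M x) p \<in> Truth)"
    if "Frm_in v p" for v p
    using Truth_ex[OF that] Tot_iff[OF that] inst_iff[OF that, of "\<lambda>q. q \<in> Truth"] by simp
  then show ?thesis by (simp add: ax_ex_def)
qed

lemma sat_ax_nex: "sat M Truth e (ax_nex 0)"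
proof -
  have "code1 6 (code2 8 v p) \<in> Truth \<longleftrightarrow>
      (\<forall>x. \<exists>w. Frm_in w p \<and> code1 6 (inst w (numeral_M x) p) \<in> Truth)"
    if p: "Frm_in v p" for v p
  proof -
    have f: "Frm p" "Vr v" "Trm (numeral_M x)" "Sent (inst v (numeral_M x) p)" for x
      using p numeral_M_closed Sent_inst by (simp_all add: Frm_in_def ClosedTrm_def)
    have "code1 6 (code2 8 v p) \<in> Truth \<longleftrightarrow> (\<forall>x. code1 6 (inst v (numeral_M x) p) \<in> Truth)"
      using Truth_neg[of "code2 8 v p"] Truth_ex[OF p] Truth_neg[OF f(4)] std_depth_inst[OF f(1,2,3)] f(2) p
      by (auto simp: Sent_code std_depth_code)
    then show ?thesis using inst_iff[OF p, of "\<lambda>q. code1 6 q \<in> Truth"] by simp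
  qed
  then show ?thesis by (simp add: ax_nex_def)
qed

lemma sat_ax_neg: "sat M Truth e (ax_neg 0)"
  using Truth_std_depth by (auto simp: ax_neg_def Truth_neg Sent_code std_depth_code)

text \<open>These rules turn an axiom into its meaning and leave its propositional structure untouched, so that
  the result can be matched against a statement about the model.\<close>

lemmas sat_eval = sat_builders sat_is_form1 sat_is_closed_term sat_is_value sat_at_num sat_at_term
  tbelow.simps val.simps fun_upd_apply lessI less_SucI zero_less_Suc Suc_less_eq
  n_not_Suc_n Suc_n_not_n nat.inject nat.distinct if_True if_False simp_thms

lemma sat_ax_reg: "sat M Truth e (ax_reg 0)"
proof -
  have main: "\<forall>p s t. (\<exists>v. Frm_in v p) \<and> ClosedTrm s \<and> ClosedTrm t \<longrightarrow>
      (\<exists>a b. Val s a \<and> Val t b \<and> a = b) \<longrightarrow>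
      (\<exists>w. Frm_in w p \<and> inst w s p \<in> Truth) = (\<exists>w. Frm_in w p \<and> inst w t p \<in> Truth)"
  proof (intro allI impI, elim exE conjE)
    fix p s t v a b
    assume p: "Frm_in v p" and st: "ClosedTrm s" "ClosedTrm t" "Val s a" "Val t b" "a = b"
    then have "value_M s = value_M t" by (simp add: Val_iff)
    from Truth_regular[OF p st(1,2) this]
    show "(\<exists>w. Frm_in w p \<and> inst w s p \<in> Truth) = (\<exists>w. Frm_in w p \<and> inst w t p \<in> Truth)"
      unfolding inst_iff[OF p, of "\<lambda>q. q \<in> Truth"] .
  qed
  show ?thesis by (simp only: ax_reg_def sat_eval) (use main in simp)
qed

lemma sat_internal_induction: "sat M Truth e internal_induction"
proof -
  have main: "\<forall>p. (\<exists>v. Frm_in v p) \<longrightarrow>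
      (\<forall>x. (\<exists>w. Frm_in w p \<and> inst w (numeral_M x) p \<in> Truth) \<longrightarrow>
        (\<exists>w. Frm_in w p \<and> inst w (numeral_M (S x)) p \<in> Truth)) \<longrightarrow>
      (\<exists>w. Frm_in w p \<and> inst w (numeral_M \<zero>) p \<in> Truth) \<longrightarrow>
      (\<forall>x. \<exists>w. Frm_in w p \<and> inst w (numeral_M x) p \<in> Truth)"
  proof (rule allI, rule impI, elim exE)
    fix p v assume p: "Frm_in v p"
    have i: "(\<exists>w. Frm_in w p \<and> inst w r p \<in> Truth) \<longleftrightarrow> inst v r p \<in> Truth" for r
      by (rule inst_iff[OF p])
    show "(\<forall>x. (\<exists>w. Frm_in w p \<and> inst w (numeral_M x) p \<in> Truth) \<longrightarrow>
        (\<exists>w. Frm_in w p \<and> inst w (numeral_M (S x)) p \<in> Truth)) \<longrightarrow>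
      (\<exists>w. Frm_in w p \<and> inst w (numeral_M \<zero>) p \<in> Truth) \<longrightarrow>
      (\<forall>x. \<exists>w. Frm_in w p \<and> inst w (numeral_M x) p \<in> Truth)"
      unfolding i
    proof (rule impI, rule impI, rule allI)
      fix x
      assume step: "\<forall>x. inst v (numeral_M x) p \<in> Truth \<longrightarrow> inst v (numeral_M (S x)) p \<in> Truth"
        and zero: "inst v (numeral_M \<zero>) p \<in> Truth"
      show "inst v (numeral_M x) p \<in> Truth"
        by (rule Truth_induction[OF p]) (erule step[rule_format], rule zero)
    qed
  qed
  show ?thesis by (simp only: internal_induction_def sat_eval) (rule main)
qed

theorem Truth_expansion: "models M Truth (WPT_minus \<union> {internal_induction})"
  using PA_model PA_model_iff[of M Truth] sat_ax_eq sat_ax_neq sat_ax_or sat_ax_nor sat_ax_ex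
    sat_ax_nex sat_ax_neg sat_ax_reg sat_internal_induction
  unfolding models_def WPT_minus_def by blast

end

theorem theorem34:
  fixes M :: "'a pa_structure"
  assumes "PA_model M"
  shows "\<exists>T. models M T (WPT_minus \<union> {internal_induction})"
  using pa.Truth_expansion[OF pa.intro[OF assms]] by blast

end
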